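(* Let $X$ be a (finite) cell complex, let $\ell\ge1$ be an integer, let $K$ be a field, and let $p\in(0,1)$, $q>0$. Then the normalizing constant $Z_{p,q}$ of the $\ell$-random-cluster model on $X$ with $K$ coefficient is expressed as $$Z_{p,q}=\left(\frac{p}{1-p}\right)^{\beta_{\ell-1}(X)} p^{r(X)} (1-p)^{\beta_{\ell}(X^{\ell})}\,T_\ell\left(X;1+\frac{q(1-p)}{p},\frac{1}{1-p}\right),$$ where $T_\ell(X;x,y)$ is the non-reduced $\ell$-Tutte polynomial of $X$ and $r(X)=\operatorname{rank}\partial_\ell$ is the rank of the cellular boundary map $\partial_\ell:C_\ell(X;K)\to C_{\ell-1}(X;K)$.
   Context: All cell complexes are finite. $X_\ell$ denotes the set of $\ell$-cells of $X$ and $X^{k}$ its $k$-skeleton. For $F\subset X_\ell$ put $X_F=X^{\ell-1}\sqcup F$, and $\Omega_\ell(X)=\{X_F: F\subset X_\ell\}$. $\beta_k(Y)=\dim_K H_k(Y;K)$ denotes the (non-reduced) $k$-th Betti number with coefficients in $K$. For $p\in[0,1]$ and $q>0$, the $\ell$-random-cluster measure on $X$ is the probability measure on $\Omega_\ell(X)$ $$\mu_{p,q}(Y)=\frac{1}{Z_{p,q}}\,p^{|Y_\ell|}(1-p)^{|X_\ell\setminus Y_\ell|}\,q^{\beta_{\ell-1}(Y)},\qquad Y\in\Omega_\ell(X),$$ where $Y_\ell$ is the set of $\ell$-cells of $Y$; thus $Z_{p,q}=\sum_{Y\in\Omega_\ell(X)}p^{|Y_\ell|}(1-p)^{|X_\ell\setminus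 Y_\ell|}q^{\beta_{\ell-1}(Y)}$. The non-reduced $\ell$-Tutte polynomial is $$T_\ell(X;x,y)=\sum_{F\subset X_\ell}(x-1)^{\beta_{\ell-1}(X_F)}(y-1)^{\beta_\ell(X_F)}.$$ *)

theory Defs
  imports "HOL-Homology.Homology" "HOL-Library.Function_Algebras"
begin

section \<open>Finite cell complexes\<close>

text \<open>The disc of dimension \<open>n\<close> lives in the same ambient space as \<^const>\<open>nsphere\<close>, so that
  the boundary of the disc of dimension \<open>Suc n\<close> is the sphere \<open>nsphere n\<close>. The disc of dimension
  \<open>0\<close> is one point with empty boundary.\<close>

definition disk :: "nat \<Rightarrow> (nat \<Rightarrow> real) topology"
  where "disk n = subtopology (powertop_real UNIV)
           {x. (\<Sum>i<n. (x i)\<^sup>2) \<le> 1 \<and> (\<forall>i\<ge>n. x i = 0)}"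

definition disk_boundary :: "nat \<Rightarrow> (nat \<Rightarrow> real) set"
  where "disk_boundary n = {x \<in> topspace (disk n). (\<Sum>i<n. (x i)\<^sup>2) = 1}"

definition disk_interior :: "nat \<Rightarrow> (nat \<Rightarrow> real) set"
  where "disk_interior n = {x \<in> topspace (disk n). (\<Sum>i<n. (x i)\<^sup>2) < 1}"

text \<open>A cell complex is a topological space with an indexed family of cells, each having a
  dimension and a characteristic map from the closed disc.\<close>

record ('a, 'c) cell_complex =
  underlying :: "'a topology"
  cells :: "'c set"
  cdim :: "'c \<Rightarrow> nat"
  charmap :: "'c \<Rightarrow> (nat \<Rightarrow> real) \<Rightarrow> 'a"

definition open_cell :: "('a, 'c) cell_complex \<Rightarrow> 'c \<Rightarrow> 'a set"
  where "open_cell X \<sigma> = charmap X \<sigma> ` disk_interior (cdim X \<sigma>)"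

text \<open>Finite CW complexes. Closure finiteness and the weak topology are automatic, since there are
  only finitely many (compact) closed cells.\<close>

definition finite_cell_complex :: "('a, 'c) cell_complex \<Rightarrow> bool"
  where "finite_cell_complex X \<longleftrightarrow>
    Hausdorff_space (underlying X) \<and>
    finite (cells X) \<and>
    disjoint_family_on (open_cell X) (cells X) \<and>
    (\<Union>\<sigma>\<in>cells X. open_cell X \<sigma>) = topspace (underlying X) \<and>
    (\<forall>\<sigma>\<in>cells X.
       continuous_map (disk (cdim X \<sigma>)) (underlying X) (charmap X \<sigma>) \<and>
       embedding_map (subtopology (disk (cdim X \<sigma>)) (disk_interior (cdim X \<sigma>)))
         (underlying X) (charmap X \<sigma>) \<and>
       charmap X \<sigma> ` disk_boundary (cdim X \<sigma>)
         \<subseteq> (\<Union>\<tau>\<in>{\<tau> \<in> cells X. cdim X \<tau> < cdim X \<sigma>}. open_cell X \<tau>))"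

definition cells_of_dim :: "('a, 'c) cell_complex \<Rightarrow> nat \<Rightarrow> 'c set"
  where "cells_of_dim X n = {\<sigma> \<in> cells X. cdim X \<sigma> = n}"

definition subcomplex :: "('a, 'c) cell_complex \<Rightarrow> 'c set \<Rightarrow> ('a, 'c) cell_complex"
  where "subcomplex X C =
    X\<lparr>underlying := subtopology (underlying X) (\<Union>\<sigma>\<in>C. open_cell X \<sigma>), cells := C\<rparr>"

definition skeleton :: "('a, 'c) cell_complex \<Rightarrow> nat \<Rightarrow> ('a, 'c) cell_complex"
  where "skeleton X n = subcomplex X {\<sigma> \<in> cells X. cdim X \<sigma> \<le> n}"

text \<open>\<open>skeleton_below X n\<close> is the point set of the skeleton of dimension \<open>n - 1\<close>; it is empty for
  \<open>n = 0\<close>.\<close>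

definition skeleton_below :: "('a, 'c) cell_complex \<Rightarrow> nat \<Rightarrow> 'a set"
  where "skeleton_below X n = (\<Union>\<sigma>\<in>{\<sigma> \<in> cells X. cdim X \<sigma> < n}. open_cell X \<sigma>)"

text \<open>\<open>X_F\<close>, for a set \<open>F\<close> of \<open>l\<close>-cells: all cells of dimension less than \<open>l\<close>, and \<open>F\<close>.\<close>

definition add_cells :: "('a, 'c) cell_complex \<Rightarrow> nat \<Rightarrow> 'c set \<Rightarrow> ('a, 'c) cell_complex"
  where "add_cells X l F = subcomplex X ({\<sigma> \<in> cells X. cdim X \<sigma> < l} \<union> F)"


section \<open>Cellular homology with coefficients in a field\<close>

text \<open>The orientation of the cells: one chosen generator of the infinite cyclic group
  \<open>H_n(D^n, S^(n-1))\<close> for each \<open>n\<close>. A different choice changes the incidence numbers below by signs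
  depending on \<open>n\<close> only.\<close>

definition disk_class :: "nat \<Rightarrow> (nat \<Rightarrow> real) chain set"
  where "disk_class n =
    (SOME g. g \<in> carrier (relative_homology_group (int n) (disk n) (disk_boundary n)) \<and>
       generate (relative_homology_group (int n) (disk n) (disk_boundary n)) {g} =
         carrier (relative_homology_group (int n) (disk n) (disk_boundary n)))"

definition cellular_group :: "('a, 'c) cell_complex \<Rightarrow> nat \<Rightarrow> 'a chain set monoid"
  where "cellular_group X n =
    relative_homology_group (int n) (underlying (skeleton X n)) (skeleton_below X n)"

text \<open>The integral cellular chain group \<open>H_n(X^n, X^(n-1))\<close> is free with the following classes,
  for \<open>\<sigma>\<close> of dimension \<open>n\<close>, as a basis.\<close>

definition cell_class :: "('a, 'c) cell_complex \<Rightarrow> 'c \<Rightarrow> 'a chain set"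
  where "cell_class X \<sigma> =
    hom_induced (int (cdim X \<sigma>)) (disk (cdim X \<sigma>)) (disk_boundary (cdim X \<sigma>))
      (underlying (skeleton X (cdim X \<sigma>))) (skeleton_below X (cdim X \<sigma>))
      (charmap X \<sigma>) (disk_class (cdim X \<sigma>))"

text \<open>The integral cellular boundary map
  \<open>H_(n+1)(X^(n+1), X^n) \<rightarrow> H_n(X^n) \<rightarrow> H_n(X^n, X^(n-1))\<close>.\<close>

definition integral_boundary :: "('a, 'c) cell_complex \<Rightarrow> nat \<Rightarrow> 'a chain set \<Rightarrow> 'a chain set"
  where "integral_boundary X n =
    hom_relboundary (int (Suc n)) (underlying (skeleton X (Suc n)))
      (skeleton_below X (Suc n)) (skeleton_below X n)"

text \<open>For \<open>\<sigma>\<close> of dimension \<open>n + 1\<close> and \<open>\<tau>\<close> of dimension \<open>n\<close>, the coefficient of \<open>\<tau>\<close> in the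
  boundary of \<open>\<sigma>\<close> (the groups of the homology library are written multiplicatively).\<close>

definition incidence :: "('a, 'c) cell_complex \<Rightarrow> nat \<Rightarrow> 'c \<Rightarrow> 'c \<Rightarrow> int"
  where "incidence X n \<sigma> =
    (SOME c :: 'c \<Rightarrow> int. integral_boundary X n (cell_class X \<sigma>) =
       finprod (cellular_group X n)
         (\<lambda>\<tau>. cell_class X \<tau> [^]\<^bsub>cellular_group X n\<^esub> c \<tau>) (cells_of_dim X n))"

text \<open>\<open>C_n(X; K)\<close>, the tensor product of the integral chain group with \<open>K\<close>, written in the basis
  of cells: functions to \<open>K\<close> supported on the \<open>n\<close>-cells.\<close>

definition chains :: "('a, 'c) cell_complex \<Rightarrow> nat \<Rightarrow> ('c \<Rightarrow> 'k::field) set"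
  where "chains X n = {f. \<forall>\<sigma>. \<sigma> \<notin> cells_of_dim X n \<longrightarrow> f \<sigma> = 0}"

fun cellular_boundary :: "('a, 'c) cell_complex \<Rightarrow> nat \<Rightarrow> ('c \<Rightarrow> 'k::field) \<Rightarrow> 'c \<Rightarrow> 'k"
  where
    "cellular_boundary X 0 f = (\<lambda>\<tau>. 0)"
  | "cellular_boundary X (Suc n) f =
      (\<lambda>\<tau>. if \<tau> \<in> cells_of_dim X n
           then \<Sum>\<sigma>\<in>cells_of_dim X (Suc n). f \<sigma> * of_int (incidence X n \<sigma> \<tau>)
           else 0)"

definition scale_chain :: "'k::field \<Rightarrow> ('c \<Rightarrow> 'k) \<Rightarrow> 'c \<Rightarrow> 'k"
  where "scale_chain a f = (\<lambda>\<sigma>. a * f \<sigma>)"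

lemma vector_space_scale_chain: "vector_space scale_chain"
  by unfold_locales (auto simp: scale_chain_def fun_eq_iff algebra_simps)

definition boundary_rank :: "'k::field itself \<Rightarrow> ('a, 'c) cell_complex \<Rightarrow> nat \<Rightarrow> nat"
  where "boundary_rank _ X n =
    vector_space.dim scale_chain
      (cellular_boundary X n ` (chains X n :: ('c \<Rightarrow> 'k) set))"

definition cycles :: "('a, 'c) cell_complex \<Rightarrow> nat \<Rightarrow> ('c \<Rightarrow> 'k::field) set"
  where "cycles X n = {f \<in> chains X n. cellular_boundary X n f = 0}"

definition boundaries :: "('a, 'c) cell_complex \<Rightarrow> nat \<Rightarrow> ('c \<Rightarrow> 'k::field) set"
  where "boundaries X n = cellular_boundary X (Suc n) ` chains X (Suc n)"

text \<open>The dimension of the quotient space \<open>V / W\<close>: the largest number of vectors in \<open>V\<close> whose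
  classes are linearly independent.\<close>

definition quotient_dim :: "('c \<Rightarrow> 'k::field) set \<Rightarrow> ('c \<Rightarrow> 'k) set \<Rightarrow> nat"
  where "quotient_dim V W =
    Max {card S |S. finite S \<and> S \<subseteq> V \<and>
      (\<forall>a. (\<Sum>v\<in>S. scale_chain (a v) v) \<in> W \<longrightarrow> (\<forall>v\<in>S. a v = 0))}"

definition betti :: "'k::field itself \<Rightarrow> nat \<Rightarrow> ('a, 'c) cell_complex \<Rightarrow> nat"
  where "betti _ n X = quotient_dim (cycles X n :: ('c \<Rightarrow> 'k) set) (boundaries X n)"


section \<open>The random-cluster model and the Tutte polynomial\<close>

definition Omega :: "('a, 'c) cell_complex \<Rightarrow> nat \<Rightarrow> ('a, 'c) cell_complex set"
  where "Omega X l = add_cells X l ` Pow (cells_of_dim X l)"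

definition rc_weight :: "'k::field itself \<Rightarrow> ('a, 'c) cell_complex \<Rightarrow> nat \<Rightarrow> real \<Rightarrow> real \<Rightarrow>
    ('a, 'c) cell_complex \<Rightarrow> real"
  where "rc_weight K X l p q Y =
    p ^ card (cells_of_dim Y l) * (1 - p) ^ card (cells_of_dim X l - cells_of_dim Y l) *
    q ^ betti K (l - 1) Y"

definition rc_normalizer :: "'k::field itself \<Rightarrow> ('a, 'c) cell_complex \<Rightarrow> nat \<Rightarrow> real \<Rightarrow> real \<Rightarrow> real"
  where "rc_normalizer K X l p q = (\<Sum>Y\<in>Omega X l. rc_weight K X l p q Y)"

definition tutte :: "'k::field itself \<Rightarrow> ('a, 'c) cell_complex \<Rightarrow> nat \<Rightarrow> real \<Rightarrow> real \<Rightarrow> real"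
  where "tutte K X l x y =
    (\<Sum>F\<in>Pow (cells_of_dim X l).
       (x - 1) ^ betti K (l - 1) (add_cells X l F) * (y - 1) ^ betti K l (add_cells X l F))"

end

theory Submission
  imports Defs "HOL-Analysis.Abstract_Topological_Spaces"
begin

text \<open>Rank-nullity gives \<open>\<beta>_n + rank \<partial>_(n+1) + rank \<partial>_n = |X_n|\<close> as soon as \<open>\<partial> \<circ> \<partial> = 0\<close>. Applied to
  \<open>X\<close>, \<open>X^l\<close> and \<open>X_F\<close>, which share all cells and incidence numbers below dimension \<open>l\<close>, this expresses
  every exponent through the rank of \<open>\<partial>_l\<close> on \<open>X\<close> and on \<open>X_F\<close>, and the identity holds term by term in
  \<open>F\<close>. The substance is \<open>\<partial> \<circ> \<partial> = 0\<close> for incidence numbers that are merely chosen coefficients: it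
  needs that the cell classes form a basis of \<open>H_n(X^n, X^(n-1))\<close>, which follows by attaching the
  \<open>n\<close>-cells one at a time.\<close>

section \<open>Linear algebra of chains\<close>

text \<open>In each term \<open>F\<close> of the sum, the rank of \<open>\<partial>_l\<close> on
  \<open>X_F\<close> stays an unknown s: both Betti numbers of \<open>X_F\<close> are affine in s,
  and s cancels from the exponents of p and of 1 - p. The top Betti number in the formula is that of
  \<open>X^l\<close> because no (l+1)-cells lower it there below \<open>|X_l| - r(X)\<close>.

  Both halves of the basis property matter. Generation makes the \<open>SOME\<close> in
  \<open>incidence\<close> pick genuine coefficients; independence turns the vanishing double
  boundary of a cell class into vanishing sums of products of incidence numbers. These are
  identities of integers, which \<open>of_int\<close> carries to a field of any characteristic.

  The obstacle to computing the homology of (Y, B), with one cell attached to \<open>B\<close>, is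
  that excision wants the closure of the removed set inside the interior of the subspace.
  \<open>B\<close> is closed but in general not open, so it is first thickened by the part of the
  cell at radii at least 1/2; radial stretching shows that this leaves the relative homology
  unchanged. The disc and its sphere are treated in the same way.\<close>

interpretation chain_vs: vector_space "scale_chain :: 'k::field \<Rightarrow> ('c \<Rightarrow> 'k) \<Rightarrow> 'c \<Rightarrow> 'k"
  by (rule vector_space_scale_chain)

section \<open>Quotient dimension and rank-nullity\<close>

text \<open>A relation modulo the span of \<open>B\<close>, with its \<open>B\<close>-part moved to
  the other side, is a relation among all of \<open>B'\<close>. It is applied with \<open>B\<close>
  a basis of a subspace, respectively of a kernel, extended to \<open>B'\<close>.\<close>

lemma independent_modulo_span:
  fixes B :: "('c \<Rightarrow> 'k::field) set"
  assumes ind: "chain_vs.independent B'" "finite B'" and sub: "B \<subseteq> B'"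
    and "(\<Sum>v\<in>B' - B. scale_chain (a v) v) \<in> chain_vs.span B"
  shows "\<forall>v\<in>B' - B. a v = 0"
proof -
  have "finite B"
    using sub ind(2) finite_subset by blast
  then obtain b where b: "(\<Sum>v\<in>B' - B. scale_chain (a v) v) = (\<Sum>v\<in>B. scale_chain (b v) v)"
    using assms(4) chain_vs.span_finite by auto
  define c where "c v = (if v \<in> B then - b v else a v)" for v
  have "(\<Sum>v\<in>B'. scale_chain (c v) v)
      = (\<Sum>v\<in>B' - B. scale_chain (c v) v) + (\<Sum>v\<in>B. scale_chain (c v) v)"
    using sub ind(2) by (rule sum.subset_diff)
  also have "(\<Sum>v\<in>B' - B. scale_chain (c v) v) = (\<Sum>v\<in>B' - B. scale_chain (a v) v)"
    by (intro sum.cong) (auto simp: c_def)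
  also have "(\<Sum>v\<in>B. scale_chain (c v) v) = - (\<Sum>v\<in>B. scale_chain (b v) v)"
    by (simp add: c_def sum_negf)
  finally have "(\<Sum>v\<in>B'. scale_chain (c v) v) = 0"
    by (simp add: b zero_fun_def)
  then have "\<forall>v\<in>B'. c v = 0"
    using ind chain_vs.independentD by blast
  then show ?thesis
    by (auto simp: c_def)
qed

text \<open>Replaces the maximum in \<open>quotient_dim\<close> by a difference of dimensions. A set
  independent modulo \<open>W\<close> stays independent after a basis \<open>B\<close> of
  \<open>W\<close> is added, which bounds its size; extending \<open>B\<close> to a basis
  \<open>B'\<close> of \<open>V\<close> attains the bound with \<open>B' - B\<close>.\<close>

lemma dim_eq_quotient_dim_add:
  fixes V W :: "('c \<Rightarrow> 'k::field) set"
  assumes V: "chain_vs.subspace V" and W: "chain_vs.subspace W" and WV: "W \<subseteq> V"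
    and fin: "finite D" "V \<subseteq> chain_vs.span D"
  shows "chain_vs.dim V = quotient_dim V W + chain_vs.dim W"
proof -
  obtain B where B: "B \<subseteq> W" "chain_vs.independent B" "W \<subseteq> chain_vs.span B"
      "card B = chain_vs.dim W"
    by (rule chain_vs.basis_exists)
  obtain B' where B': "B \<subseteq> B'" "B' \<subseteq> V" "chain_vs.independent B'" "V \<subseteq> chain_vs.span B'"
    using chain_vs.maximal_independent_subset_extend[of B V] B(1,2) WV by auto
  have fin_indep: "finite S \<and> card S \<le> chain_vs.dim V"
    if SV: "S \<subseteq> V" and indS: "chain_vs.independent S" for S
  proof -
    obtain S' where S': "S \<subseteq> S'" "S' \<subseteq> V" "chain_vs.independent S'" "V \<subseteq> chain_vs.span S'"
      using chain_vs.maximal_independent_subset_extend[of S V] SV indS by metis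
    have "finite S'"
      using chain_vs.independent_span_bound[OF fin(1) S'(3)] S'(2) fin(2) by auto
    moreover have "card S' = chain_vs.dim V"
      using S' by (simp add: chain_vs.basis_card_eq_dim)
    ultimately show ?thesis
      using S'(1) by (metis card_mono finite_subset)
  qed
  have finB': "finite B'" and cardB': "card B' = chain_vs.dim V"
    using fin_indep B' by (auto simp: chain_vs.basis_card_eq_dim)
  have finB: "finite B"
    using B'(1) finB' finite_subset by blast
  have spanB: "chain_vs.span B = W"
    using B(1,3) W chain_vs.span_minimal by blast
  define P where "P S \<longleftrightarrow> finite S \<and> S \<subseteq> V \<and>
      (\<forall>a. (\<Sum>v\<in>S. scale_chain (a v) v) \<in> W \<longrightarrow> (\<forall>v\<in>S. a v = 0))" for S
  have upper: "card S + card B \<le> chain_vs.dim V" if "P S" for S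
  proof -
    have S: "finite S" "S \<subseteq> V"
      and S0: "\<And>a v. (\<Sum>v\<in>S. scale_chain (a v) v) \<in> W \<Longrightarrow> v \<in> S \<Longrightarrow> a v = 0"
      using that by (auto simp: P_def)
    have disj: "S \<inter> B = {}"
    proof (rule ccontr)
      assume "S \<inter> B \<noteq> {}"
      then obtain v where v: "v \<in> S" "v \<in> B" by blast
      \<comment> \<open>The combination with coefficient 1 at \<open>v\<close> and 0 elsewhere is
        \<open>v\<close> itself, which lies in \<open>W\<close>; so the coefficient 1 would have to
        vanish.\<close>
      have "(\<Sum>u\<in>S. scale_chain (if u = v then 1 else 0) u) = v"
        using S v by (simp add: if_distrib[of "\<lambda>a. scale_chain a _"] sum.delta cong: if_cong)
      then have "(1::'k) = 0"
        using S0[of "\<lambda>u. if u = v then 1 else 0" v] v B(1) by auto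
      then show False by simp
    qed
    have "chain_vs.independent (S \<union> B)"
    proof (rule chain_vs.independent_if_scalars_zero)
      show "finite (S \<union> B)" using S finB by simp
      fix a x assume sum: "(\<Sum>x\<in>S \<union> B. scale_chain (a x) x) = 0" and x: "x \<in> S \<union> B"
      have eq: "(\<Sum>x\<in>S. scale_chain (a x) x) + (\<Sum>x\<in>B. scale_chain (a x) x) = 0"
        using sum by (subst (asm) sum.union_disjoint) (use S finB disj in auto)
      have "(\<Sum>x\<in>B. scale_chain (a x) x) \<in> W"
        unfolding spanB[symmetric]
        by (intro chain_vs.span_sum chain_vs.span_scale chain_vs.span_base)
      then have "- (\<Sum>x\<in>B. scale_chain (a x) x) \<in> W"
        by (rule chain_vs.subspace_neg[OF W])
      then have "(\<Sum>x\<in>S. scale_chain (a x) x) \<in> W"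
        using eq by (simp add: add_eq_0_iff2)
      then have aS: "\<forall>x\<in>S. a x = 0"
        using S0 by blast
      then have "(\<Sum>x\<in>B. scale_chain (a x) x) = 0"
        using eq by simp
      then have "\<forall>x\<in>B. a x = 0"
        using B(2) finB chain_vs.independentD by blast
      then show "a x = 0" using aS x by blast
    qed
    then have "card (S \<union> B) \<le> chain_vs.dim V"
      using fin_indep S(2) B(1) WV by (meson Un_least order_trans)
    then show ?thesis
      using disj S finB by (simp add: card_Un_disjoint)
  qed
  have "P (B' - B)"
    unfolding P_def
  proof (intro conjI allI impI)
    show "finite (B' - B)" "B' - B \<subseteq> V" using finB' B' by auto
    show "\<forall>v\<in>B' - B. a v = 0" if "(\<Sum>v\<in>B' - B. scale_chain (a v) v) \<in> W" for a
      using independent_modulo_span[OF B'(3) finB' B'(1)] that by (simp add: spanB)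
  qed
  moreover have "card (B' - B) + card B = chain_vs.dim V"
    using cardB' B'(1) finB finB' card_mono[of B' B] by (simp add: card_Diff_subset)
  moreover have "quotient_dim V W = Max {card S |S. P S}"
    by (simp add: quotient_dim_def P_def)
  moreover have "Max {card S |S. P S} = card (B' - B)"
  proof (rule Max_eqI)
    \<comment> \<open>\<open>Max\<close> is meaningful on finite sets only; the bound by the
      dimension of \<open>V\<close> makes this set finite.\<close>
    have "{card S |S. P S} \<subseteq> {..chain_vs.dim V}"
      using upper by fastforce
    then show "finite {card S |S. P S}"
      using finite_subset by blast
    show "y \<le> card (B' - B)" if "y \<in> {card S |S. P S}" for y
      using that upper \<open>card (B' - B) + card B = chain_vs.dim V\<close> by fastforce
    show "card (B' - B) \<in> {card S |S. P S}"
      using \<open>P (B' - B)\<close> by blast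
  qed
  ultimately show ?thesis
    using B(4) by simp
qed


text \<open>The type of cells may be infinite, so the ambient function space need not be
  finite-dimensional; hence the form relative to a subspace inside a finite span. A basis of the
  kernel is extended to one of \<open>V\<close>, and \<open>f\<close> is injective on the span of
  the added vectors.\<close>

lemma rank_nullity_chain:
  fixes V :: "('c \<Rightarrow> 'k::field) set" and f :: "('c \<Rightarrow> 'k) \<Rightarrow> 'd \<Rightarrow> 'k"
  assumes V: "chain_vs.subspace V" and f: "Vector_Spaces.linear scale_chain scale_chain f"
    and fin: "finite D" "V \<subseteq> chain_vs.span D"
  shows "chain_vs.dim V = chain_vs.dim {x \<in> V. f x = 0} + chain_vs.dim (f ` V)"
proof -
  interpret f: Vector_Spaces.linear "scale_chain :: 'k \<Rightarrow> ('c \<Rightarrow> 'k) \<Rightarrow> 'c \<Rightarrow> 'k" scale_chain f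
    by (rule f)
  let ?K = "{x \<in> V. f x = 0}"
  obtain B where B: "B \<subseteq> ?K" "chain_vs.independent B" "?K \<subseteq> chain_vs.span B"
      "card B = chain_vs.dim ?K"
    by (rule chain_vs.basis_exists)
  obtain B' where B': "B \<subseteq> B'" "B' \<subseteq> V" "chain_vs.independent B'" "V \<subseteq> chain_vs.span B'"
    using chain_vs.maximal_independent_subset_extend[of B V] B(1,2) by auto
  have finB': "finite B'"
    using chain_vs.independent_span_bound[OF fin(1) B'(3)] B'(2) fin(2) by auto
  have finB: "finite B"
    using B'(1) finB' finite_subset by blast
  let ?S = "B' - B"
  have inj: "inj_on f (chain_vs.span ?S)"
  proof (subst f.inj_on_iff_eq_0)
    show "\<forall>x\<in>chain_vs.span ?S. f x = 0 \<longrightarrow> x = 0"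
    proof (intro ballI impI)
      fix x assume x: "x \<in> chain_vs.span ?S" "f x = 0"
      then obtain a where a: "x = (\<Sum>v\<in>?S. scale_chain (a v) v)"
        using chain_vs.span_finite[of ?S] finB' by auto
      have "x \<in> V"
        using x(1) chain_vs.span_minimal[of ?S V] V B'(2) by blast
      then have "x \<in> chain_vs.span B"
        using x(2) B(3) by blast
      then have "\<forall>v\<in>?S. a v = 0"
        using independent_modulo_span[OF B'(3) finB' B'(1)] a by blast
      then show "x = 0" by (simp add: a)
    qed
  qed (rule chain_vs.subspace_span)
  have ind: "chain_vs.independent (f ` ?S)"
    by (rule f.independent_injective_image[OF _ inj])
      (use B'(3) chain_vs.independent_mono in blast)
  have "f ` V \<subseteq> chain_vs.span (f ` ?S)"
  proof -
    have "f ` V \<subseteq> chain_vs.span (f ` B')"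
      using B'(4) f.span_image by blast
    also have "\<dots> \<subseteq> chain_vs.span (f ` ?S)"
    proof (rule chain_vs.span_minimal)
      have "f b \<in> chain_vs.span (f ` ?S)" if "b \<in> B'" for b
      proof (cases "b \<in> B")
        case True
        then have "f b = 0" using B(1) by blast
        then show ?thesis by (simp only: chain_vs.span_zero)
      qed (use that in \<open>auto intro: chain_vs.span_base\<close>)
      then show "f ` B' \<subseteq> chain_vs.span (f ` ?S)" by blast
    qed (rule chain_vs.subspace_span)
    finally show ?thesis .
  qed
  then have "card (f ` ?S) = chain_vs.dim (f ` V)"
    by (rule chain_vs.basis_card_eq_dim[rotated]) (use B'(2) ind in auto)
  moreover have "card (f ` ?S) = card ?S"
    using inj chain_vs.span_superset by (intro card_image) (rule inj_on_subset)
  moreover have "card ?S + card B = card B'"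
    using B'(1) finB finB' by (simp add: card_Diff_subset card_mono)
  moreover have "card B' = chain_vs.dim V"
    using B' by (simp add: chain_vs.basis_card_eq_dim)
  ultimately show ?thesis
    using B(4) by linarith
qed

section \<open>Chain spaces in coordinates, and Betti numbers\<close>

lemma subspace_chains: "chain_vs.subspace (chains X n)"
  by (auto simp: chains_def chain_vs.subspace_def scale_chain_def)

definition cell_indicator :: "'c \<Rightarrow> 'c \<Rightarrow> 'k::field"
  where "cell_indicator \<sigma> = (\<lambda>\<tau>. if \<tau> = \<sigma> then 1 else 0)"

lemma inj_cell_indicator: "inj (cell_indicator :: 'c \<Rightarrow> 'c \<Rightarrow> 'k::field)"
proof (rule injI)
  show "a = b" if "cell_indicator a = (cell_indicator b :: 'c \<Rightarrow> 'k)" for a b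
    using fun_cong[OF that, of a] by (auto simp: cell_indicator_def split: if_splits)
qed

lemma sum_cell_indicator:
  assumes "finite A"
  shows "(\<Sum>\<sigma>\<in>A. scale_chain (f \<sigma>) (cell_indicator \<sigma> :: 'c \<Rightarrow> 'k::field)) =
    (\<lambda>\<tau>. if \<tau> \<in> A then f \<tau> else 0)"
proof
  fix \<tau>
  have *: "(\<Sum>\<sigma>\<in>A. g \<sigma>) \<tau> = (\<Sum>\<sigma>\<in>A. g \<sigma> \<tau>)" for g :: "'c \<Rightarrow> 'c \<Rightarrow> 'k"
    using assms by induction auto
  show "(\<Sum>\<sigma>\<in>A. scale_chain (f \<sigma>) (cell_indicator \<sigma> :: 'c \<Rightarrow> 'k)) \<tau> = (if \<tau> \<in> A then f \<tau> else 0)"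
    using assms by (simp add: * scale_chain_def cell_indicator_def if_distrib cong: if_cong)
qed

lemma chains_subset_span:
  assumes "finite (cells_of_dim X n)"
  shows "(chains X n :: ('c \<Rightarrow> 'k::field) set) \<subseteq> chain_vs.span (cell_indicator ` cells_of_dim X n)"
proof
  fix f :: "'c \<Rightarrow> 'k" assume "f \<in> chains X n"
  then have "f = (\<Sum>\<sigma>\<in>cells_of_dim X n. scale_chain (f \<sigma>) (cell_indicator \<sigma>))"
    by (auto simp: sum_cell_indicator[OF assms] chains_def fun_eq_iff)
  also have "\<dots> \<in> chain_vs.span (cell_indicator ` cells_of_dim X n)"
    by (intro chain_vs.span_sum chain_vs.span_scale chain_vs.span_base) auto
  finally show "f \<in> chain_vs.span (cell_indicator ` cells_of_dim X n)" .
qed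

lemma dim_chains:
  assumes fin: "finite (cells_of_dim X n)"
  shows "chain_vs.dim (chains X n :: ('c \<Rightarrow> 'k::field) set) = card (cells_of_dim X n)"
proof -
  let ?B = "cell_indicator ` cells_of_dim X n :: ('c \<Rightarrow> 'k) set"
  have inj: "inj_on (cell_indicator :: 'c \<Rightarrow> 'c \<Rightarrow> 'k) (cells_of_dim X n)"
    using inj_cell_indicator by (rule inj_on_subset) simp
  have "chain_vs.independent ?B"
  proof (rule chain_vs.independent_if_scalars_zero)
    show "finite ?B" using fin by simp
    fix a x assume sum: "(\<Sum>x\<in>?B. scale_chain (a x) x) = 0" and "x \<in> ?B"
    then obtain \<sigma> where \<sigma>: "\<sigma> \<in> cells_of_dim X n" "x = cell_indicator \<sigma>" by blast
    have "(\<lambda>\<tau>. if \<tau> \<in> cells_of_dim X n then a (cell_indicator \<tau>) else 0) = 0"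
      using sum by (simp add: sum.reindex[OF inj] sum_cell_indicator[OF fin])
    then show "a x = 0"
      using \<sigma> by (auto dest: fun_cong[where x = \<sigma>])
  qed
  moreover have "?B \<subseteq> chains X n"
    by (auto simp: chains_def cell_indicator_def)
  moreover have "(chains X n :: ('c \<Rightarrow> 'k) set) \<subseteq> chain_vs.span ?B"
    by (rule chains_subset_span[OF fin])
  ultimately show ?thesis
    using chain_vs.basis_card_eq_dim[of ?B "chains X n"]
    by (simp add: card_image[OF inj])
qed

lemma linear_cellular_boundary:
  "Vector_Spaces.linear scale_chain scale_chain (cellular_boundary X n :: ('c \<Rightarrow> 'k::field) \<Rightarrow> 'c \<Rightarrow> 'k)"
proof (cases n)
  case 0
  then show ?thesis
    by (auto simp: Vector_Spaces.linear_iff vector_space_scale_chain scale_chain_def fun_eq_iff zero_fun_def)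
next
  case (Suc m)
  then show ?thesis
    by (auto simp: Vector_Spaces.linear_iff vector_space_scale_chain scale_chain_def fun_eq_iff
        algebra_simps sum.distrib sum_distrib_left)
qed

lemma cellular_boundary_in_chains: "cellular_boundary X (Suc n) f \<in> chains X n"
  by (simp add: chains_def)

lemma subspace_cycles: "chain_vs.subspace (cycles X n :: ('c \<Rightarrow> 'k::field) set)"
proof -
  interpret Vector_Spaces.linear scale_chain scale_chain "cellular_boundary X n :: ('c \<Rightarrow> 'k) \<Rightarrow> 'c \<Rightarrow> 'k"
    by (rule linear_cellular_boundary)
  show ?thesis
    using subspace_chains[of X n] by (auto simp: cycles_def chain_vs.subspace_def add scale)
qed

lemma subspace_boundaries: "chain_vs.subspace (boundaries X n :: ('c \<Rightarrow> 'k::field) set)"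
proof -
  interpret Vector_Spaces.linear scale_chain scale_chain "cellular_boundary X (Suc n) :: ('c \<Rightarrow> 'k) \<Rightarrow> 'c \<Rightarrow> 'k"
    by (rule linear_cellular_boundary)
  show ?thesis
    unfolding boundaries_def by (intro subspace_image subspace_chains)
qed

text \<open>Two dimension counts added up: boundaries inside cycles, and cycles as the kernel of the
  boundary map on chains. The inclusion \<open>sub\<close> is
  \<open>\<partial> \<circ> \<partial> = 0\<close>, which has to wait for the topology. Degree 0
  needs no separate treatment, since \<open>cellular_boundary X 0\<close> is the zero map.\<close>

lemma betti_eq:
  fixes X :: "('a, 'c) cell_complex"
  assumes fin: "finite (cells_of_dim X n)"
    and sub: "(boundaries X n :: ('c \<Rightarrow> 'k::field) set) \<subseteq> cycles X n"
  shows "betti TYPE('k) n X + boundary_rank TYPE('k) X (Suc n) + boundary_rank TYPE('k) X n =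
    card (cells_of_dim X n)"
proof -
  let ?D = "cell_indicator ` cells_of_dim X n :: ('c \<Rightarrow> 'k) set"
  have span: "chains X n \<subseteq> chain_vs.span ?D" and finD: "finite ?D"
    using chains_subset_span[OF fin] fin by auto
  then have "cycles X n \<subseteq> chain_vs.span ?D"
    by (auto simp: cycles_def)
  then have "chain_vs.dim (cycles X n :: ('c \<Rightarrow> 'k) set) =
      betti TYPE('k) n X + boundary_rank TYPE('k) X (Suc n)"
    using dim_eq_quotient_dim_add[OF subspace_cycles subspace_boundaries sub finD]
    unfolding betti_def boundary_rank_def boundaries_def by simp
  moreover have "chain_vs.dim (cycles X n :: ('c \<Rightarrow> 'k) set) + boundary_rank TYPE('k) X n =
      card (cells_of_dim X n)"
    using rank_nullity_chain[OF subspace_chains linear_cellular_boundary[of X n] finD span]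
    by (simp add: cycles_def boundary_rank_def dim_chains[OF fin] del: cellular_boundary.simps)
  ultimately show ?thesis by simp
qed

section \<open>Discs\<close>

text \<open>The discs are defined by sums of squares; the square root makes the quantity homogeneous
  of degree one, so that radial motions are divisions.\<close>

definition radius :: "nat \<Rightarrow> (nat \<Rightarrow> real) \<Rightarrow> real"
  where "radius n x = sqrt (\<Sum>i<n. (x i)\<^sup>2)"

lemma radius_nonneg: "0 \<le> radius n x"
  by (simp add: radius_def sum_nonneg)

lemma radius_scale: "radius n (\<lambda>i. c * x i) = \<bar>c\<bar> * radius n x"
  by (simp add: radius_def power_mult_distrib real_sqrt_mult flip: sum_distrib_left)

lemma topspace_disk: "topspace (disk n) = {x. radius n x \<le> 1 \<and> (\<forall>i\<ge>n. x i = 0)}"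
  by (auto simp: disk_def radius_def)

lemma disk_boundary_eq: "disk_boundary n = {x \<in> topspace (disk n). radius n x = 1}"
  by (auto simp: disk_boundary_def radius_def)

lemma disk_interior_eq: "disk_interior n = {x \<in> topspace (disk n). radius n x < 1}"
  by (auto simp: disk_interior_def radius_def)

lemma disk_interior_subset: "disk_interior n \<subseteq> topspace (disk n)"
  and disk_interior_Int_boundary: "disk_interior n \<inter> disk_boundary n = {}"
  and disk_interior_Un_boundary: "disk_interior n \<union> disk_boundary n = topspace (disk n)"
  by (auto simp: disk_boundary_eq disk_interior_eq topspace_disk)

text \<open>\<open>powertop_real UNIV\<close> is the euclidean topology of the function type, so the
  rules for \<open>continuous_on\<close>, \<open>closed\<close> and \<open>compact\<close> become
  applicable to discs.\<close>

lemma disk_eq_top_of_set: "disk n = top_of_set (topspace (disk n))"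
  unfolding topspace_disk by (simp add: disk_def euclidean_product_topology radius_def)

lemma continuous_on_radius [continuous_intros]:
  assumes "continuous_on S f"
  shows "continuous_on S (\<lambda>x. radius n (f x))"
proof -
  have "continuous_on S (\<lambda>x. f x i)" for i
    using assms by (rule continuous_on_product_then_coordinatewise)
  then show ?thesis
    unfolding radius_def by (intro continuous_intros)
qed

text \<open>A closed subset of the infinite-dimensional cube with sides [-1, 1], which is compact by
  Tychonoff.\<close>

lemma compact_space_disk: "compact_space (disk n)"
proof -
  have "compact (PiE UNIV (\<lambda>i::nat. {-1..1::real}))"
    using compactin_PiE[of "\<lambda>_. euclideanreal" UNIV "\<lambda>_. {-1..1::real}"]
    by (simp add: euclidean_product_topology)
  moreover have "topspace (disk n) \<subseteq> PiE UNIV (\<lambda>i::nat. {-1..1::real})"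
  proof
    fix x assume x: "x \<in> topspace (disk n)"
    have "x i \<in> {-1..1}" for i
    proof (cases "i < n")
      case True
      have "(x i)\<^sup>2 \<le> (\<Sum>i<n. (x i)\<^sup>2)"
        using True by (intro member_le_sum) auto
      also have "\<dots> \<le> 1"
        using x by (simp add: topspace_disk radius_def)
      finally show ?thesis
        by (simp add: abs_square_le_1 abs_le_iff)
    qed (use x in \<open>auto simp: topspace_disk\<close>)
    then show "x \<in> PiE UNIV (\<lambda>i::nat. {-1..1::real})" by auto
  qed
  moreover have "closed (topspace (disk n))"
  proof -
    have "topspace (disk n) = {x. radius n x \<le> 1} \<inter> (\<Inter>i\<in>{n..}. {x. x i = 0})"
      by (auto simp: topspace_disk)
    moreover have "closed {x. radius n x \<le> 1}"
      by (intro closed_Collect_le continuous_intros)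
    moreover have "closed {x :: nat \<Rightarrow> real. x i = 0}" for i
      by (intro closed_Collect_eq continuous_intros) auto
    ultimately show ?thesis by (simp add: closed_INT closed_Int)
  qed
  ultimately have "compact (topspace (disk n))"
    by (metis compact_Int_closed inf.absorb_iff2)
  then show ?thesis
    by (subst disk_eq_top_of_set) (simp add: compact_space_subtopology)
qed

lemma Hausdorff_space_disk: "Hausdorff_space (disk n)"
  by (subst disk_eq_top_of_set) (simp add: Hausdorff_space_subtopology)

lemma contractible_space_disk: "contractible_space (disk n)"
proof -
  let ?h = "\<lambda>(t::real, x::nat \<Rightarrow> real) i. (1 - t) * x i"
  have "homotopic_with (\<lambda>x. True) (disk n) (disk n) id (\<lambda>x i. 0)"
  proof (subst homotopic_with, simp, intro exI conjI ballI)
    have "continuous_on ({0..1} \<times> topspace (disk n)) ?h"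
      unfolding case_prod_unfold
      by (intro continuous_on_coordinatewise_then_product continuous_intros
          continuous_on_product_then_coordinatewise[OF continuous_on_snd[OF continuous_on_id]])
    moreover have "?h \<in> {0..1} \<times> topspace (disk n) \<rightarrow> topspace (disk n)"
      using radius_nonneg by (auto simp: topspace_disk radius_scale mult_le_one)
    ultimately show "continuous_map (prod_topology (top_of_set {0..1}) (disk n)) (disk n) ?h"
      by (subst (1 2) disk_eq_top_of_set)
        (simp add: continuous_map_in_subtopology image_subset_iff_funcset)
  qed auto
  then show ?thesis
    unfolding contractible_space_def by blast
qed

lemma subtopology_disk_boundary: "subtopology (disk (Suc n)) (disk_boundary (Suc n)) = nsphere n"
proof -
  have "{x. (\<Sum>i<Suc n. (x i)\<^sup>2) \<le> 1 \<and> (\<forall>i\<ge>Suc n. x i = 0)} \<inter> disk_boundary (Suc n) =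
      {x. (\<Sum>i\<le>n. (x i)\<^sup>2) = 1 \<and> (\<forall>i>n. x i = 0)}"
    by (auto simp: disk_boundary_def disk_def lessThan_Suc_atMost Suc_le_eq)
  then show ?thesis
    by (simp add: disk_def nsphere subtopology_subtopology)
qed

section \<open>Homology of the disc modulo its boundary\<close>

text \<open>In positive dimension the disc is contractible, so the group is the reduced homology of
  the boundary sphere one degree lower. In dimension 0 the boundary is empty and the disc is a
  point, so the coefficient group appears directly.\<close>

lemma disk_homology_iso_integer:
  "relative_homology_group (int n) (disk n) (disk_boundary n) \<cong> integer_group"
proof (cases n)
  case 0
  have "topspace (disk 0) = {\<lambda>i. 0}" "disk_boundary 0 = {}"
    by (auto simp: topspace_disk disk_boundary_eq radius_def)
  then show ?thesis
    using homology_coefficients 0 by simp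
next
  case (Suc m)
  \<comment> \<open>The passage to reduced homology requires a nonempty subspace; the first unit
    vector lies on the sphere.\<close>
  have "(\<lambda>i. if i = 0 then 1 else 0) \<in> topspace (nsphere m)"
    by (rule in_topspace_nsphere)
  then have "topspace (disk (Suc m)) \<inter> disk_boundary (Suc m) \<noteq> {}"
    by (auto simp flip: subtopology_disk_boundary)
  then have "relative_homology_group (int n) (disk n) (disk_boundary n) \<cong>
      reduced_homology_group (int n - 1) (nsphere m)"
    using isomorphic_group_relative_homology_of_contractible[OF contractible_space_disk, of n "disk_boundary n" "int n"]
    by (simp add: Suc subtopology_disk_boundary)
  also have "\<dots> \<cong> integer_group"
    using reduced_homology_group_nsphere(1)[of m] Suc by simp
  finally show ?thesis .
qed

text \<open>Being isomorphic to the integers, the group has a generator, so the \<open>SOME\<close>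
  in \<open>disk_class\<close> does pick one. It has infinite order: some power of it corresponds to
  1, so its own image under the isomorphism is a nonzero integer.\<close>

lemma disk_class_generates:
  fixes n
  defines "G \<equiv> relative_homology_group (int n) (disk n) (disk_boundary n)"
  shows disk_class_carrier: "disk_class n \<in> carrier G"
    and carrier_disk_homology: "carrier G = range (\<lambda>k::int. disk_class n [^]\<^bsub>G\<^esub> k)"
    and disk_class_pow_eq_one: "\<And>k::int. disk_class n [^]\<^bsub>G\<^esub> k = \<one>\<^bsub>G\<^esub> \<Longrightarrow> k = 0"
proof -
  interpret group G by (simp add: G_def)
  have iso: "G \<cong> integer_group"
    unfolding G_def by (rule disk_homology_iso_integer)
  then have "cyclic_group G"
    using isomorphic_group_cyclicity cyclic_integer_group group_integer_group is_group by blast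
  then obtain g where g: "g \<in> carrier G" "subgroup_generated G {g} = G"
    by (auto simp: cyclic_group_def)
  then have "generate G {g} = carrier G"
    by (metis carrier_subgroup_generated Int_insert_right_if1 inf_bot_right)
  with g have *: "disk_class n \<in> carrier G \<and> generate G {disk_class n} = carrier G"
    unfolding disk_class_def G_def by (intro someI) blast
  then show c: "disk_class n \<in> carrier G" and r: "carrier G = range (\<lambda>k::int. disk_class n [^]\<^bsub>G\<^esub> k)"
    using generate_pow[of "disk_class n"] by (auto simp: full_SetCompr_eq)
  show "k = 0" if k: "disk_class n [^]\<^bsub>G\<^esub> k = \<one>\<^bsub>G\<^esub>" for k :: int
  proof -
    obtain h where h: "h \<in> iso G integer_group"
      using iso by (auto simp: is_iso_def)
    interpret h: group_hom G integer_group h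
      using h is_group by (simp add: group_hom_def group_hom_axioms_def iso_def)
    have hp: "h (disk_class n [^]\<^bsub>G\<^esub> j) = j * h (disk_class n)" for j :: int
      using h.hom_int_pow[OF c, of j] by (simp add: mult.commute)
    have "h ` carrier G = UNIV"
      using h by (simp add: iso_def bij_betw_def)
    then obtain x where "x \<in> carrier G" "h x = 1"
      by (metis UNIV_I imageE)
    then have "h (disk_class n) \<noteq> 0"
      using r hp by auto
    moreover have "k * h (disk_class n) = 0"
      using hp[of k] k h.hom_one by simp
    ultimately show ?thesis by simp
  qed
qed

section \<open>Attaching a cell\<close>

text \<open>At \<open>t = 1\<close> the stretching carries the collar of radii at least \<open>1/2\<close> onto the boundary sphere;
  it fixes the sphere at all times.\<close>

definition stretch :: "nat \<Rightarrow> real \<Rightarrow> (nat \<Rightarrow> real) \<Rightarrow> nat \<Rightarrow> real"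
  where "stretch n t x = (\<lambda>i. x i / max (radius n x) (1 - t / 2))"

text \<open>The radius 1/2 is the value of \<open>1 - t / 2\<close> at \<open>t = 1\<close>: outside
  this open disc the final stretch divides by the radius itself.\<close>

definition disk_core :: "nat \<Rightarrow> (nat \<Rightarrow> real) set"
  where "disk_core n = {x \<in> topspace (disk n). radius n x < 1/2}"

lemma disk_core_subset: "disk_core n \<subseteq> disk_interior n"
  by (auto simp: disk_core_def disk_interior_eq)

lemma radius_stretch:
  assumes "t \<in> {0..1}"
  shows "radius n (stretch n t x) = radius n x / max (radius n x) (1 - t / 2)"
proof -
  have "max (radius n x) (1 - t / 2) > 0"
    using assms by auto
  then show ?thesis
    using radius_scale[of n "1 / max (radius n x) (1 - t / 2)" x] by (simp add: stretch_def)
qed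

lemma stretch_in_disk:
  assumes "t \<in> {0..1}" "x \<in> topspace (disk n)"
  shows "stretch n t x \<in> topspace (disk n)"
proof -
  have "max (radius n x) (1 - t / 2) > 0"
    using assms by auto
  then have "radius n (stretch n t x) \<le> 1"
    by (simp add: radius_stretch[OF assms(1)])
  then show ?thesis
    using assms(2) by (auto simp: topspace_disk stretch_def)
qed

lemma stretch_0:
  assumes "x \<in> topspace (disk n)"
  shows "stretch n 0 x = x"
  using assms by (auto simp: topspace_disk stretch_def max_def)

lemma stretch_boundary:
  assumes "t \<in> {0..1}" "x \<in> disk_boundary n"
  shows "stretch n t x = x"
  using assms by (auto simp: disk_boundary_eq stretch_def max_def)

text \<open>The divisor is at most 1 on the disc, so radii never shrink. This keeps the homotopy
  inside the collar at all times.\<close>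

lemma stretch_outside_core:
  assumes "t \<in> {0..1}" "x \<in> topspace (disk n)" "x \<notin> disk_core n"
  shows "stretch n t x \<in> topspace (disk n) - disk_core n"
proof -
  have x: "1/2 \<le> radius n x" "radius n x \<le> 1"
    using assms by (auto simp: disk_core_def topspace_disk)
  have "max (radius n x) (1 - t / 2) \<le> 1" "max (radius n x) (1 - t / 2) > 0"
    using assms x by auto
  then have "radius n x \<le> radius n (stretch n t x)"
    using x by (simp add: radius_stretch[OF assms(1)] pos_le_divide_eq mult_left_le)
  then show ?thesis
    using stretch_in_disk[OF assms(1,2)] x by (auto simp: disk_core_def)
qed

lemma stretch_1_outside_core:
  assumes "x \<in> topspace (disk n)" "x \<notin> disk_core n"
  shows "stretch n 1 x \<in> disk_boundary n"
proof -
  have "1/2 \<le> radius n x"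
    using assms by (auto simp: disk_core_def topspace_disk)
  then have "radius n (stretch n 1 x) = 1"
    by (simp add: radius_stretch max_def)
  then show ?thesis
    using stretch_in_disk[OF _ assms(1), of 1] by (auto simp: disk_boundary_eq)
qed

text \<open>The \<open>max\<close> keeps the divisor at least 1/2, so the centre of the disc causes
  no singularity.\<close>

lemma continuous_map_stretch:
  "continuous_map (prod_topology (top_of_set {0..1::real}) (disk n)) (disk n) (\<lambda>(t, x). stretch n t x)"
proof -
  have "continuous_on ({0..1} \<times> topspace (disk n)) (\<lambda>(t, x). stretch n t x)"
    unfolding case_prod_unfold stretch_def
    by (intro continuous_on_coordinatewise_then_product continuous_intros
        continuous_on_product_then_coordinatewise[OF continuous_on_snd[OF continuous_on_id]]) auto
  moreover have "(\<lambda>(t, x). stretch n t x) \<in> {0..1} \<times> topspace (disk n) \<rightarrow> topspace (disk n)"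
    using stretch_in_disk by fastforce
  ultimately show ?thesis
    by (subst (1 2) disk_eq_top_of_set)
      (simp add: continuous_map_in_subtopology image_subset_iff_funcset)
qed

section \<open>Thickening the base of an attached cell and excising it\<close>

text \<open>A relative homeomorphism from (disc, sphere) to (Y, B). Injectivity on the open disc is
  enough: compactness of the disc and the Hausdorff property make \<Phi> a homeomorphism onto Y - B.
  The base \<open>B\<close> may itself contain cells of dimension \<open>n\<close>, which permits
  attaching them one at a time.\<close>

locale attached_cell =
  fixes Y :: "'a topology" and B :: "'a set" and n :: nat and \<Phi> :: "(nat \<Rightarrow> real) \<Rightarrow> 'a"
  assumes Hausdorff: "Hausdorff_space Y"
    and closed_base: "closedin Y B"
    and continuous: "continuous_map (disk n) Y \<Phi>"
    and boundary: "\<Phi> ` disk_boundary n \<subseteq> B"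
    and inj: "inj_on \<Phi> (disk_interior n)"
    and interior: "\<Phi> ` disk_interior n \<inter> B = {}"
    and cover: "topspace Y = B \<union> \<Phi> ` disk_interior n"
begin

text \<open>The thickened base: it leaves room around \<open>B\<close> for excision and still
  deforms onto \<open>B\<close>.\<close>

definition collar :: "'a set"
  where "collar = topspace Y - \<Phi> ` disk_core n"

text \<open>The stretching carried over to \<open>Y\<close>. \<Phi> may identify points of the
  sphere, so it is inverted on the open disc only; the two cases fit together because stretching
  fixes the sphere.\<close>

definition push :: "real \<Rightarrow> 'a \<Rightarrow> 'a"
  where "push t y = (if y \<in> B then y else \<Phi> (stretch n t (inv_into (disk_interior n) \<Phi> y)))"

lemma base_subset: "B \<subseteq> topspace Y"
  using closed_base by (rule closedin_subset)

lemma closed_map_char: "closed_map (disk n) Y \<Phi>"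
  by (rule continuous_imp_closed_map_gen[OF compact_space_disk Hausdorff_imp_kc_space[OF Hausdorff] continuous])

lemma char_in_base_iff:
  assumes "x \<in> topspace (disk n)"
  shows "\<Phi> x \<in> B \<longleftrightarrow> x \<in> disk_boundary n"
  using assms boundary interior disk_interior_Un_boundary[of n] disk_interior_Int_boundary[of n] by blast

lemma char_in_topspace: "x \<in> topspace (disk n) \<Longrightarrow> \<Phi> x \<in> topspace Y"
  using continuous_map_image_subset_topspace[OF continuous] by blast

lemma cover_char: "topspace Y = B \<union> \<Phi> ` topspace (disk n)"
  using cover base_subset char_in_topspace disk_interior_subset[of n] by auto

lemma char_in_core_image_iff:
  assumes "x \<in> topspace (disk n)"
  shows "\<Phi> x \<in> \<Phi> ` disk_core n \<longleftrightarrow> x \<in> disk_core n"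
proof
  assume "\<Phi> x \<in> \<Phi> ` disk_core n"
  then obtain y where y: "y \<in> disk_core n" "\<Phi> x = \<Phi> y" by blast
  then have yi: "y \<in> disk_interior n" using disk_core_subset by blast
  then have "\<Phi> x \<notin> B" using y interior by auto
  then have "x \<in> disk_interior n"
    using assms char_in_base_iff disk_interior_Un_boundary by blast
  then show "x \<in> disk_core n" using inj yi y by (metis inj_onD)
qed auto

lemma char_in_collar_iff:
  assumes "x \<in> topspace (disk n)"
  shows "\<Phi> x \<in> collar \<longleftrightarrow> x \<notin> disk_core n"
  using assms char_in_topspace char_in_core_image_iff by (auto simp: collar_def)

lemma base_subset_collar: "B \<subseteq> collar"
  using base_subset interior disk_core_subset[of n] by (auto simp: collar_def)

lemma push_char:
  assumes "t \<in> {0..1}" "x \<in> topspace (disk n)"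
  shows "push t (\<Phi> x) = \<Phi> (stretch n t x)"
proof (cases "x \<in> disk_boundary n")
  case True
  then show ?thesis
    using assms boundary by (auto simp: push_def stretch_boundary)
next
  case False
  then have "x \<in> disk_interior n" "\<Phi> x \<notin> B"
    using assms disk_interior_Un_boundary char_in_base_iff by blast+
  then show ?thesis
    by (simp add: push_def inv_into_f_f[OF inj])
qed

text \<open>Pasting over the closed sets [0,1] x B, where the map is the projection, and [0,1] x
  (closed cell), where continuity is tested on [0,1] x disc and there reduces to that of
  \<open>stretch\<close>.\<close>

lemma continuous_map_push:
  "continuous_map (prod_topology (top_of_set {0..1::real}) Y) Y (\<lambda>(t, y). push t y)"
proof -
  let ?I = "top_of_set {0..1::real}" and ?D = "\<Phi> ` topspace (disk n)"
  let ?T = "\<lambda>b. topspace ?I \<times> (if b then B else ?D)"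
  have cloD: "closedin Y ?D"
    using closed_map_char by (simp add: closed_map_def)
  have sub: "subtopology (prod_topology ?I Y) (topspace ?I \<times> A) = prod_topology ?I (subtopology Y A)" for A
    by (subst prod_topology_subtopology(2)) (simp_all add: subtopology_subtopology flip: prod_topology_subtopology)
  have contB: "continuous_map (prod_topology ?I (subtopology Y B)) Y (\<lambda>(t, y). push t y)"
  proof (rule continuous_map_eq)
    show "continuous_map (prod_topology ?I (subtopology Y B)) Y snd"
      by (metis continuous_map_into_fulltopology continuous_map_snd)
  qed (auto simp: push_def)
  have contD: "continuous_map (prod_topology ?I (subtopology Y ?D)) Y (\<lambda>(t, y). push t y)"
  proof -
    let ?q = "\<lambda>(t::real, x). (t, \<Phi> x)"
    have contq: "continuous_map (prod_topology ?I (disk n)) (prod_topology ?I (subtopology Y ?D)) ?q"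
      by (subst continuous_map_prod_top)
        (use continuous in \<open>auto simp: continuous_map_in_subtopology\<close>)
    \<comment> \<open>That \<Phi> is a quotient map onto its image would not suffice: its product
      with the interval has to be one. Compactness of [0,1] x disc gives this directly.\<close>
    have "quotient_map (prod_topology ?I (disk n)) (prod_topology ?I (subtopology Y ?D)) ?q"
    proof (rule continuous_closed_imp_quotient_map[OF contq])
      have "compact_space (prod_topology ?I (disk n))"
        by (simp add: compact_space_prod_topology compact_space_disk compact_space_subtopology)
      moreover have "Hausdorff_space (prod_topology ?I (subtopology Y ?D))"
        by (simp add: Hausdorff_space_prod_topology Hausdorff_space_subtopology Hausdorff)
      ultimately show "closed_map (prod_topology ?I (disk n)) (prod_topology ?I (subtopology Y ?D)) ?q"
        using contq by (simp add: continuous_imp_closed_map_gen Hausdorff_imp_kc_space)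
      show "?q ` topspace (prod_topology ?I (disk n)) = topspace (prod_topology ?I (subtopology Y ?D))"
        using char_in_topspace by (auto simp: image_iff)
    qed
    moreover have "continuous_map (prod_topology ?I (disk n)) Y ((\<lambda>(t, y). push t y) \<circ> ?q)"
    proof (rule continuous_map_eq)
      show "continuous_map (prod_topology ?I (disk n)) Y (\<Phi> \<circ> (\<lambda>(t, x). stretch n t x))"
        by (rule continuous_map_compose[OF continuous_map_stretch continuous])
    qed (auto simp: push_char)
    ultimately show ?thesis
      by (rule continuous_compose_quotient_map)
  qed
  show ?thesis
  proof (rule pasting_lemma_closed[where I = UNIV and T = ?T and f = "\<lambda>b::bool. \<lambda>(t, y). push t y"])
    show "closedin (prod_topology ?I Y) (?T b)" for b
      using closed_base cloD by (simp add: closedin_prod_Times_iff)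
    show "continuous_map (subtopology (prod_topology ?I Y) (?T b)) Y (\<lambda>(t, y). push t y)" for b
      using contB contD by (simp only: sub) (cases b; simp)
    show "\<exists>j. j \<in> UNIV \<and> x \<in> ?T j \<and> (\<lambda>(t, y). push t y) x = (\<lambda>(t, y). push t y) x"
      if "x \<in> topspace (prod_topology ?I Y)" for x
      using that cover_char by (auto simp: ex_bool_eq)
  qed auto
qed

lemma push_base: "y \<in> B \<Longrightarrow> push t y = y"
  by (simp add: push_def)

lemma push_0: "y \<in> topspace Y \<Longrightarrow> push 0 y = y"
  using cover_char push_char[of 0] push_base by (auto simp: stretch_0)

lemma push_collar:
  assumes "t \<in> {0..1}" "y \<in> collar"
  shows "push t y \<in> collar"
proof (cases "y \<in> B")
  case True
  then show ?thesis using assms by (simp add: push_base)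
next
  case False
  then obtain x where x: "x \<in> topspace (disk n)" "y = \<Phi> x"
    using assms(2) cover_char by (auto simp: collar_def)
  then show ?thesis
    using assms stretch_outside_core[of t x n] by (auto simp: push_char char_in_collar_iff)
qed

lemma push_1_collar:
  assumes "y \<in> collar"
  shows "push 1 y \<in> B"
proof (cases "y \<in> B")
  case True
  then show ?thesis by (simp add: push_base)
next
  case False
  then obtain x where x: "x \<in> topspace (disk n)" "y = \<Phi> x"
    using assms(1) cover_char by (auto simp: collar_def)
  then have "stretch n 1 x \<in> disk_boundary n"
    using assms by (intro stretch_1_outside_core) (auto simp: char_in_collar_iff)
  then show ?thesis
    using x boundary by (auto simp: push_char)
qed

text \<open>Wanted for \<open>B\<close> and for \<open>collar\<close>: an equivalence of pairs
  needs, on either side, a homotopy that preserves the subspace.\<close>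

lemma homotopic_push:
  assumes "A \<subseteq> topspace Y" "\<And>t y. t \<in> {0..1} \<Longrightarrow> y \<in> A \<Longrightarrow> push t y \<in> A"
  shows "homotopic_with (\<lambda>h. h \<in> A \<rightarrow> A) Y Y (push 1) id"
proof -
  have "homotopic_with (\<lambda>h. h \<in> A \<rightarrow> A) Y Y id (push 1)"
  proof (subst homotopic_with)
    show "(h \<in> A \<rightarrow> A) = (k \<in> A \<rightarrow> A)" if "\<And>x. x \<in> topspace Y \<Longrightarrow> h x = k x" for h k
      using that assms(1) by (auto simp: Pi_iff subset_iff)
    show "\<exists>h. continuous_map (prod_topology (top_of_set {0..1::real}) Y) Y h \<and>
        (\<forall>x\<in>topspace Y. h (0, x) = id x) \<and> (\<forall>x\<in>topspace Y. h (1, x) = push 1 x) \<and>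
        (\<forall>t\<in>{0..1}. (\<lambda>x. h (t, x)) \<in> A \<rightarrow> A)"
    proof (intro exI conjI)
      show "continuous_map (prod_topology (top_of_set {0..1::real}) Y) Y (\<lambda>(t, y). push t y)"
        by (rule continuous_map_push)
    qed (use push_0 assms(2) in auto)
  qed
  then show ?thesis
    by (simp add: homotopic_with_sym)
qed

text \<open>\<open>push 1\<close> is the homotopy inverse: it carries the collar into
  \<open>B\<close>, and the homotopy to the identity preserves both subspaces.\<close>

lemma iso_base_collar:
  "hom_induced p Y B Y collar id \<in> iso (relative_homology_group p Y B) (relative_homology_group p Y collar)"
proof (rule homotopy_equivalence_relative_homology_group_isomorphism[where g = "push 1"])
  have "continuous_map Y (prod_topology (top_of_set {0..1::real}) Y) (\<lambda>y. (1, y))"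
    by (auto simp: continuous_map_paired)
  from continuous_map_compose[OF this continuous_map_push]
  show "continuous_map Y Y (push 1)"
    by (simp add: o_def)
  show "push 1 \<in> collar \<rightarrow> B"
    using push_1_collar by auto
  show "homotopic_with (\<lambda>h. h \<in> B \<rightarrow> B) Y Y (push 1 \<circ> id) id"
    using homotopic_push[of B] base_subset push_base by simp
  show "homotopic_with (\<lambda>h. h \<in> collar \<rightarrow> collar) Y Y (id \<circ> push 1) id"
    using homotopic_push[of collar] push_collar by (simp add: collar_def)
qed (use base_subset_collar in auto)

lemma iso_excision:
  "hom_induced p (subtopology Y (topspace Y - B)) (collar - B) Y collar id \<in>
    iso (relative_homology_group p (subtopology Y (topspace Y - B)) (collar - B))
      (relative_homology_group p Y collar)"
proof -
  \<comment> \<open>The closed half-disc, in contrast to the open \<open>disk_core\<close>. Its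
    image is closed, so the complement of the image is an open set between \<open>B\<close> and the
    collar.\<close>
  let ?C = "{x \<in> topspace (disk n). radius n x \<le> 1/2}"
  have "closedin (disk n) ?C"
  proof -
    have "?C = topspace (disk n) \<inter> {x. radius n x \<le> 1/2}" by blast
    moreover have "closed {x. radius n x \<le> 1/2}"
      by (intro closed_Collect_le continuous_intros)
    ultimately show ?thesis
      by (subst disk_eq_top_of_set) (simp add: closedin_closed_Int)
  qed
  then have "closedin Y (\<Phi> ` ?C)"
    using closed_map_char by (simp add: closed_map_def)
  then have "openin Y (topspace Y - \<Phi> ` ?C)"
    by blast
  moreover have "topspace Y - \<Phi> ` ?C \<subseteq> collar"
    by (auto simp: collar_def disk_core_def)
  ultimately have "topspace Y - \<Phi> ` ?C \<subseteq> Y interior_of collar"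
    by (simp add: interior_of_maximal)
  moreover have "B \<subseteq> topspace Y - \<Phi> ` ?C"
    using base_subset char_in_base_iff by (auto simp: disk_boundary_eq)
  moreover have "Y closure_of B = B"
    using closed_base by (simp add: closure_of_closedin)
  ultimately have "Y closure_of B \<subseteq> Y interior_of collar"
    by auto
  then show ?thesis
    using homology_excision_axiom[of Y B collar "topspace Y" p] by (simp add: collar_def)
qed

text \<open>Away from the base \<Phi> is a continuous closed bijection, hence a homeomorphism. The
  source pair is written as a difference of sets because excision for the disc produces it in that
  form.\<close>

lemma iso_interior:
  "hom_induced p (subtopology (disk n) (topspace (disk n) - disk_boundary n))
      ((topspace (disk n) - disk_core n) - disk_boundary n)
      (subtopology Y (topspace Y - B)) (collar - B) \<Phi> \<in>
    iso (relative_homology_group p (subtopology (disk n) (topspace (disk n) - disk_boundary n))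
        ((topspace (disk n) - disk_core n) - disk_boundary n))
      (relative_homology_group p (subtopology Y (topspace Y - B)) (collar - B))"
proof (rule homeomorphic_map_relative_homology_iso)
  have [simp]: "topspace (disk n) - disk_boundary n = disk_interior n"
    using disk_interior_Un_boundary[of n] disk_interior_Int_boundary[of n] by blast
  have im: "\<Phi> ` disk_interior n = topspace Y - B"
    using cover interior by blast
  \<comment> \<open>The restriction of a closed map is closed when taken over a full preimage, so an
    equality is wanted here.\<close>
  have pre: "{x \<in> topspace (disk n). \<Phi> x \<in> topspace Y - B} = disk_interior n"
    using char_in_base_iff char_in_topspace disk_interior_Un_boundary[of n] disk_interior_Int_boundary[of n] by blast
  show "homeomorphic_map (subtopology (disk n) (topspace (disk n) - disk_boundary n))
      (subtopology Y (topspace Y - B)) \<Phi>"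
  proof (rule bijective_closed_imp_homeomorphic_map)
    show "continuous_map (subtopology (disk n) (topspace (disk n) - disk_boundary n))
      (subtopology Y (topspace Y - B)) \<Phi>"
      using continuous im by (auto simp: continuous_map_in_subtopology continuous_map_from_subtopology)
    show "closed_map (subtopology (disk n) (topspace (disk n) - disk_boundary n))
      (subtopology Y (topspace Y - B)) \<Phi>"
      using closed_map_restriction[OF closed_map_char pre] by simp
  qed (use im disk_interior_subset[of n] inj in \<open>auto simp: Int_absorb1\<close>)
  show "topspace (disk n) - disk_core n - disk_boundary n
      \<subseteq> topspace (subtopology (disk n) (topspace (disk n) - disk_boundary n))"
    using disk_interior_Un_boundary[of n] by auto
  show "\<Phi> ` (topspace (disk n) - disk_core n - disk_boundary n) = collar - B"
  proof (rule subset_antisym)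
    show "\<Phi> ` (topspace (disk n) - disk_core n - disk_boundary n) \<subseteq> collar - B"
      using char_in_collar_iff char_in_base_iff by auto
    show "collar - B \<subseteq> \<Phi> ` (topspace (disk n) - disk_core n - disk_boundary n)"
    proof
      fix y assume y: "y \<in> collar - B"
      then obtain x where x: "x \<in> topspace (disk n)" "y = \<Phi> x"
        using cover_char by (auto simp: collar_def)
      then show "y \<in> \<Phi> ` (topspace (disk n) - disk_core n - disk_boundary n)"
        using y char_in_collar_iff char_in_base_iff by auto
    qed
  qed
qed

end

text \<open>The disc is the model case, with its sphere as base. The thickening and excision
  isomorphisms thus hold on the source side of \<Phi> as well.\<close>

lemma attached_cell_disk: "attached_cell (disk n) (disk_boundary n) n id"
proof
  have "closed {x. radius n x = 1}"
    by (intro closed_Collect_eq continuous_intros)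
  moreover have "disk_boundary n = topspace (disk n) \<inter> {x. radius n x = 1}"
    by (auto simp: disk_boundary_eq)
  ultimately show "closedin (disk n) (disk_boundary n)"
    by (subst disk_eq_top_of_set) (simp add: closedin_closed_Int)
qed (use disk_interior_Int_boundary disk_interior_Un_boundary Hausdorff_space_disk in auto)

text \<open>Both pairs are compared with the pairs (open cell, open collar) by excision, and there the
  characteristic map is a homeomorphism.\<close>

theorem (in attached_cell) iso_attached_cell:
  "hom_induced p (disk n) (disk_boundary n) Y B \<Phi> \<in>
    iso (relative_homology_group p (disk n) (disk_boundary n)) (relative_homology_group p Y B)"
proof -
  interpret D: attached_cell "disk n" "disk_boundary n" n id
    by (rule attached_cell_disk)
  have Dc: "D.collar = topspace (disk n) - disk_core n"
    by (simp add: D.collar_def)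
  let ?DI = "subtopology (disk n) (topspace (disk n) - disk_boundary n)"
  let ?YI = "subtopology Y (topspace Y - B)"
  let ?H = "\<lambda>X A. carrier (relative_homology_group p X A)"
  let ?a = "hom_induced p ?DI (D.collar - disk_boundary n) (disk n) D.collar id"
  let ?b = "hom_induced p (disk n) (disk_boundary n) (disk n) D.collar id"
  let ?e = "hom_induced p ?YI (collar - B) Y collar id"
  let ?d = "hom_induced p Y B Y collar id"
  let ?fI = "hom_induced p ?DI (D.collar - disk_boundary n) ?YI (collar - B) \<Phi>"
  let ?fV = "hom_induced p (disk n) D.collar Y collar \<Phi>"
  let ?f = "hom_induced p (disk n) (disk_boundary n) Y B \<Phi>"
  have bij: "bij_betw ?a (?H ?DI (D.collar - disk_boundary n)) (?H (disk n) D.collar)"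
    "bij_betw ?b (?H (disk n) (disk_boundary n)) (?H (disk n) D.collar)"
    "bij_betw ?e (?H ?YI (collar - B)) (?H Y collar)"
    "bij_betw ?d (?H Y B) (?H Y collar)"
    "bij_betw ?fI (?H ?DI (D.collar - disk_boundary n)) (?H ?YI (collar - B))"
    using D.iso_excision D.iso_base_collar iso_excision iso_base_collar iso_interior
    by (auto simp: iso_def Dc)
  have VV: "\<Phi> \<in> D.collar \<rightarrow> collar"
    using char_in_collar_iff by (auto simp: Dc)
  have cont0: "continuous_map ?DI ?YI \<Phi>" and im0: "\<Phi> \<in> D.collar - disk_boundary n \<rightarrow> collar - B"
    using continuous char_in_topspace char_in_base_iff char_in_collar_iff
    by (auto simp: continuous_map_in_subtopology continuous_map_from_subtopology Dc)
  \<comment> \<open>Bijectivity is carried along two commuting squares: from \<open>?fI\<close> to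
    \<open>?fV\<close> by excision, then from \<open>?fV\<close> to \<open>?f\<close> by
    thickening.\<close>
  have "?fV \<circ> ?a = ?e \<circ> ?fI"
    by (subst (1 2) hom_induced_compose[symmetric])
      (use continuous cont0 im0 VV in \<open>auto simp: continuous_map_from_subtopology\<close>)
  then have "bij_betw (?fV \<circ> ?a) (?H ?DI (D.collar - disk_boundary n)) (?H Y collar)"
    using bij_betw_trans[OF bij(5,3)] by simp
  then have fV: "bij_betw ?fV (?H (disk n) D.collar) (?H Y collar)"
    using bij_betw_comp_iff[OF bij(1)] by blast
  have "?d \<circ> ?f = ?fV \<circ> ?b"
    by (subst (1 2) hom_induced_compose[symmetric])
      (use continuous VV base_subset_collar D.base_subset_collar boundary in auto)
  then have "bij_betw (?d \<circ> ?f) (?H (disk n) (disk_boundary n)) (?H Y collar)"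
    using bij_betw_trans[OF bij(2) fV] by simp
  moreover have "?f ` ?H (disk n) (disk_boundary n) \<subseteq> ?H Y B"
    using hom_induced_carrier by blast
  ultimately have "bij_betw ?f (?H (disk n) (disk_boundary n)) (?H Y B)"
    using bij_betw_comp_iff2[OF bij(4)] by blast
  then show ?thesis
    by (simp add: iso_def hom_induced_hom)
qed

section \<open>The cellular chain groups\<close>

definition cell_space :: "('a, 'c) cell_complex \<Rightarrow> 'c set \<Rightarrow> 'a set"
  where "cell_space X C = (\<Union>\<sigma>\<in>C. open_cell X \<sigma>)"

lemma cell_space_mono: "C \<subseteq> D \<Longrightarrow> cell_space X C \<subseteq> cell_space X D"
  by (auto simp: cell_space_def)

text \<open>Stronger than being a subcomplex: every cell brings along all cells of smaller
  dimension, so attaching maps land inside at once. Skeleta, \<open>X_F\<close> and partially filled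
  layers have this form.\<close>

definition lower_cells :: "('a, 'c) cell_complex \<Rightarrow> 'c set \<Rightarrow> bool"
  where "lower_cells X C \<longleftrightarrow>
    C \<subseteq> cells X \<and> (\<forall>\<sigma>\<in>C. \<forall>\<tau>\<in>cells X. cdim X \<tau> < cdim X \<sigma> \<longrightarrow> \<tau> \<in> C)"

lemma lower_cells_subset: "lower_cells X C \<Longrightarrow> C \<subseteq> cells X"
  by (simp only: lower_cells_def)

lemma lower_cellsD: "lower_cells X C \<Longrightarrow> \<sigma> \<in> C \<Longrightarrow> {\<tau> \<in> cells X. cdim X \<tau> < cdim X \<sigma>} \<subseteq> C"
  unfolding lower_cells_def by blast

context
  fixes X :: "('a, 'c) cell_complex"
  assumes X: "finite_cell_complex X"
begin

lemma finite_cells: "finite (cells X)"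
  and Hausdorff_underlying: "Hausdorff_space (underlying X)"
  and disjoint_open_cells: "disjoint_family_on (open_cell X) (cells X)"
  and topspace_underlying: "topspace (underlying X) = cell_space X (cells X)"
  using X by (auto simp: finite_cell_complex_def cell_space_def)

lemma finite_cells_of_dim: "finite (cells_of_dim X n)"
  using finite_cells by (simp add: cells_of_dim_def)

lemma charmap_continuous:
  assumes "\<sigma> \<in> cells X"
  shows "continuous_map (disk (cdim X \<sigma>)) (underlying X) (charmap X \<sigma>)"
  using X assms by (auto simp: finite_cell_complex_def)

lemma charmap_inj:
  assumes "\<sigma> \<in> cells X"
  shows "inj_on (charmap X \<sigma>) (disk_interior (cdim X \<sigma>))"
proof -
  have "embedding_map (subtopology (disk (cdim X \<sigma>)) (disk_interior (cdim X \<sigma>)))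
      (underlying X) (charmap X \<sigma>)"
    using X assms by (auto simp: finite_cell_complex_def)
  then have "inj_on (charmap X \<sigma>) (topspace (subtopology (disk (cdim X \<sigma>)) (disk_interior (cdim X \<sigma>))))"
    unfolding embedding_map_def homeomorphic_map_def by blast
  then show ?thesis
    using disk_interior_subset by (simp add: Int_absorb1)
qed

lemma charmap_boundary:
  assumes "\<sigma> \<in> cells X"
  shows "charmap X \<sigma> ` disk_boundary (cdim X \<sigma>) \<subseteq> cell_space X {\<tau> \<in> cells X. cdim X \<tau> < cdim X \<sigma>}"
  using X assms by (auto simp: finite_cell_complex_def cell_space_def)

lemma cell_space_Int:
  assumes "C \<subseteq> cells X" "D \<subseteq> cells X"
  shows "cell_space X C \<inter> cell_space X D = cell_space X (C \<inter> D)"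
proof (rule subset_antisym)
  show "cell_space X C \<inter> cell_space X D \<subseteq> cell_space X (C \<inter> D)"
  proof
    fix x assume "x \<in> cell_space X C \<inter> cell_space X D"
    then obtain \<sigma> \<tau> where *: "\<sigma> \<in> C" "x \<in> open_cell X \<sigma>" "\<tau> \<in> D" "x \<in> open_cell X \<tau>"
      by (auto simp: cell_space_def)
    then have "\<sigma> = \<tau>"
      using disjoint_family_onD[OF disjoint_open_cells, of \<sigma> \<tau>] assms by blast
    then show "x \<in> cell_space X (C \<inter> D)"
      using * by (auto simp: cell_space_def)
  qed
qed (auto simp: cell_space_def)

lemma charmap_disk:
  assumes "lower_cells X C" "\<sigma> \<in> C"
  shows "charmap X \<sigma> ` topspace (disk (cdim X \<sigma>)) \<subseteq> cell_space X C"
proof -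
  have "\<sigma> \<in> cells X" and "{\<tau> \<in> cells X. cdim X \<tau> < cdim X \<sigma>} \<subseteq> C"
    using lower_cells_subset[OF assms(1)] lower_cellsD[OF assms] assms(2) by blast+
  from charmap_boundary[OF this(1)] cell_space_mono[OF this(2)]
  have "charmap X \<sigma> ` disk_boundary (cdim X \<sigma>) \<subseteq> cell_space X C"
    by (rule order_trans)
  moreover have "charmap X \<sigma> ` disk_interior (cdim X \<sigma>) \<subseteq> cell_space X C"
    using assms(2) by (auto simp: cell_space_def open_cell_def)
  ultimately show ?thesis
    unfolding disk_interior_Un_boundary[symmetric] by (simp add: image_Un)
qed

text \<open>Boundaries of the cells stay inside, so the open cells may be replaced by closed ones:
  finitely many compact sets in a Hausdorff space.\<close>

lemma closedin_cell_space:
  assumes "lower_cells X C"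
  shows "closedin (underlying X) (cell_space X C)"
proof -
  have "cell_space X C = (\<Union>\<sigma>\<in>C. charmap X \<sigma> ` topspace (disk (cdim X \<sigma>)))"
  proof (rule subset_antisym)
    show "cell_space X C \<subseteq> (\<Union>\<sigma>\<in>C. charmap X \<sigma> ` topspace (disk (cdim X \<sigma>)))"
      unfolding cell_space_def open_cell_def by (intro UN_mono image_mono disk_interior_subset subset_refl)
  qed (intro UN_least charmap_disk[OF assms])
  moreover have "C \<subseteq> cells X"
    using assms by (rule lower_cells_subset)
  moreover have "closedin (underlying X) (charmap X \<sigma> ` topspace (disk (cdim X \<sigma>)))" if "\<sigma> \<in> cells X" for \<sigma>
    using image_compactin[OF _ charmap_continuous[OF that]] compact_space_disk Hausdorff_underlying
    by (intro compactin_imp_closedin) (auto simp: compact_space_def)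
  moreover have "finite C"
    using \<open>C \<subseteq> cells X\<close> finite_cells by (rule finite_subset)
  ultimately show ?thesis
    by (auto intro!: closedin_Union)
qed

text \<open>The two hypotheses on lower sets together say that no cell of \<open>C\<close> has
  dimension greater than that of \<sigma>, so \<sigma> may be attached last.\<close>

lemma attached_cell_cell_space:
  assumes C: "lower_cells X C" and C': "lower_cells X (C - {\<sigma>})" and \<sigma>: "\<sigma> \<in> C"
  shows "attached_cell (subtopology (underlying X) (cell_space X C)) (cell_space X (C - {\<sigma>}))
    (cdim X \<sigma>) (charmap X \<sigma>)"
proof
  have \<sigma>X: "\<sigma> \<in> cells X"
    using lower_cells_subset[OF C] \<sigma> by blast
  have sub: "{\<tau> \<in> cells X. cdim X \<tau> < cdim X \<sigma>} \<subseteq> C - {\<sigma>}"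
    using lower_cellsD[OF C \<sigma>] by auto
  show "Hausdorff_space (subtopology (underlying X) (cell_space X C))"
    by (simp add: Hausdorff_space_subtopology Hausdorff_underlying)
  show "closedin (subtopology (underlying X) (cell_space X C)) (cell_space X (C - {\<sigma>}))"
    by (rule closedin_subset_topspace[OF closedin_cell_space[OF C']]) (rule cell_space_mono, blast)
  show "continuous_map (disk (cdim X \<sigma>)) (subtopology (underlying X) (cell_space X C)) (charmap X \<sigma>)"
    using charmap_continuous[OF \<sigma>X] charmap_disk[OF C \<sigma>]
    by (simp add: continuous_map_in_subtopology image_subset_iff_funcset)
  show "charmap X \<sigma> ` disk_boundary (cdim X \<sigma>) \<subseteq> cell_space X (C - {\<sigma>})"
    using charmap_boundary[OF \<sigma>X] cell_space_mono[OF sub, of X] by (rule order_trans)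
  show "inj_on (charmap X \<sigma>) (disk_interior (cdim X \<sigma>))"
    by (rule charmap_inj[OF \<sigma>X])
  have "cell_space X {\<sigma>} \<inter> cell_space X (C - {\<sigma>}) = cell_space X ({\<sigma>} \<inter> (C - {\<sigma>}))"
    by (rule cell_space_Int) (use \<sigma>X lower_cells_subset[OF C'] in simp_all)
  moreover have "cell_space X {\<sigma>} = charmap X \<sigma> ` disk_interior (cdim X \<sigma>)" "cell_space X ({\<sigma>} \<inter> (C - {\<sigma>})) = {}"
    by (auto simp: cell_space_def open_cell_def)
  ultimately show "charmap X \<sigma> ` disk_interior (cdim X \<sigma>) \<inter> cell_space X (C - {\<sigma>}) = {}"
    by metis
  have "cell_space X C \<subseteq> topspace (underlying X)"
    using cell_space_mono[OF lower_cells_subset[OF C], of X] by (simp add: topspace_underlying)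
  moreover have "cell_space X C = cell_space X (C - {\<sigma>}) \<union> open_cell X \<sigma>"
    using \<sigma> by (auto simp: cell_space_def)
  ultimately show "topspace (subtopology (underlying X) (cell_space X C)) =
      cell_space X (C - {\<sigma>}) \<union> charmap X \<sigma> ` disk_interior (cdim X \<sigma>)"
    unfolding open_cell_def topspace_subtopology by (metis Int_absorb1)
qed

end

section \<open>Finite products in commutative groups\<close>

lemma trivial_groupD: "trivial_group G \<Longrightarrow> x \<in> carrier G \<Longrightarrow> x = \<one>\<^bsub>G\<^esub>"
  by (simp add: trivial_group_def)

lemma hom_finprod:
  assumes "comm_group G" "comm_group H" "h \<in> hom G H" "finite A" "f \<in> A \<rightarrow> carrier G"
  shows "h (finprod G f A) = finprod H (\<lambda>x. h (f x)) A"
proof -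
  interpret G: comm_group G by fact
  interpret H: comm_group H by fact
  interpret group_hom G H h
    using assms(3) by (simp add: group_hom_def group_hom_axioms_def G.is_group H.is_group)
  show ?thesis
    using assms(4,5) by (induction A) (auto simp: Pi_iff)
qed

lemma (in comm_group) finprod_int_pow:
  assumes "finite A" "f \<in> A \<rightarrow> carrier G"
  shows "finprod G f A [^] (k::int) = finprod G (\<lambda>x. f x [^] k) A"
  using assms by (induction A) (auto simp: Pi_iff int_pow_distrib)

text \<open>Matrix multiplication in multiplicative notation: substituting combinations into a
  combination multiplies the coefficient matrices. It serves to expand a double boundary.\<close>

lemma (in comm_group) finprod_int_pow_sum:
  assumes "finite A" "finite B" "e \<in> B \<rightarrow> carrier G"
  shows "finprod G (\<lambda>a. finprod G (\<lambda>b. e b [^] (d a b :: int)) B [^] (c a :: int)) A =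
    finprod G (\<lambda>b. e b [^] (\<Sum>a\<in>A. c a * d a b)) B"
  using assms(1)
proof (induction A)
  case (insert a A)
  have cl: "(\<lambda>b. e b [^] f b) \<in> B \<rightarrow> carrier G" for f :: "_ \<Rightarrow> int"
    using assms(3) by auto
  have "finprod G (\<lambda>a. finprod G (\<lambda>b. e b [^] d a b) B [^] c a) (insert a A) =
      finprod G (\<lambda>b. e b [^] d a b) B [^] c a \<otimes>
      finprod G (\<lambda>a. finprod G (\<lambda>b. e b [^] d a b) B [^] c a) A"
    using insert(1,2) finprod_closed[OF cl] by (intro finprod_insert) auto
  also have "\<dots> = finprod G (\<lambda>b. (e b [^] d a b) [^] c a) B \<otimes> finprod G (\<lambda>b. e b [^] (\<Sum>a\<in>A. c a * d a b)) B"
    unfolding insert.IH by (simp only: finprod_int_pow[OF assms(2) cl])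
  also have "\<dots> = finprod G (\<lambda>b. (e b [^] d a b) [^] c a \<otimes> e b [^] (\<Sum>a\<in>A. c a * d a b)) B"
    using assms(3) by (intro finprod_multf[symmetric]) auto
  also have "\<dots> = finprod G (\<lambda>b. e b [^] (\<Sum>a\<in>insert a A. c a * d a b)) B"
    using assms(3) insert(1,2)
    by (intro finprod_cong') (auto simp: int_pow_pow int_pow_mult Pi_iff mult.commute)
  finally show ?case .
qed simp

section \<open>The cell classes as a basis of relative homology\<close>

locale cell_layer =
  fixes X :: "('a, 'c) cell_complex" and n :: nat
  assumes X: "finite_cell_complex X"
begin

abbreviation "low \<equiv> {\<sigma> \<in> cells X. cdim X \<sigma> < n}"

text \<open>\<open>T\<close> interpolates between the skeleton below dimension \<open>n\<close>
  (empty \<open>T\<close>) and the \<open>n\<close>-skeleton (all \<open>n\<close>-cells), as the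
  induction over cells requires.\<close>

definition layer :: "'c set \<Rightarrow> 'a topology"
  where "layer T = subtopology (underlying X) (cell_space X (low \<union> T))"

abbreviation "layer_group T \<equiv> relative_homology_group (int n) (layer T) (cell_space X low)"

definition layer_class :: "'c set \<Rightarrow> 'c \<Rightarrow> 'a chain set"
  where "layer_class T \<tau> = hom_induced (int n) (disk n) (disk_boundary n) (layer T) (cell_space X low)
    (charmap X \<tau>) (disk_class n)"

lemma lower_cells_layer: "T \<subseteq> cells_of_dim X n \<Longrightarrow> lower_cells X (low \<union> T)"
  by (auto simp: lower_cells_def cells_of_dim_def)

lemma topspace_layer:
  assumes "T \<subseteq> cells_of_dim X n"
  shows "topspace (layer T) = cell_space X (low \<union> T)"
proof -
  have "cell_space X (low \<union> T) \<subseteq> cell_space X (cells X)"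
    using assms by (intro cell_space_mono) (auto simp: cells_of_dim_def)
  then show ?thesis
    by (auto simp: layer_def topspace_underlying[OF X])
qed

text \<open>Cells of equal dimension do not meet each other's boundaries, so any \<sigma> in
  \<open>T\<close> may play the last cell. Independence uses this for every \<sigma>.\<close>

lemma attached_cell_layer:
  assumes "T \<subseteq> cells_of_dim X n" "\<sigma> \<in> T"
  shows "attached_cell (layer T) (cell_space X (low \<union> (T - {\<sigma>}))) n (charmap X \<sigma>)"
proof -
  have "cdim X \<sigma> = n"
    using assms by (auto simp: cells_of_dim_def)
  moreover have "low \<union> T - {\<sigma>} = low \<union> (T - {\<sigma>})"
    using \<open>cdim X \<sigma> = n\<close> by auto
  moreover have "lower_cells X (low \<union> (T - {\<sigma>}))"
    using assms(1) by (intro lower_cells_layer) blast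
  ultimately show ?thesis
    using attached_cell_cell_space[OF X lower_cells_layer[OF assms(1)], of \<sigma>] assms(2)
    unfolding layer_def by (metis UnI2)
qed

lemma continuous_charmap_layer:
  assumes "T \<subseteq> cells_of_dim X n" "\<tau> \<in> T"
  shows "continuous_map (disk n) (layer T) (charmap X \<tau>)"
  using attached_cell.continuous[OF attached_cell_layer[OF assms]] .

lemma charmap_boundary_low:
  assumes "\<tau> \<in> cells_of_dim X n"
  shows "charmap X \<tau> \<in> disk_boundary n \<rightarrow> cell_space X low"
  using charmap_boundary[OF X, of \<tau>] assms by (auto simp: cells_of_dim_def)

lemma continuous_layer_id:
  assumes "T \<subseteq> T'"
  shows "continuous_map (layer T) (layer T') id"
proof -
  have "cell_space X (low \<union> T) \<subseteq> cell_space X (low \<union> T')"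
    using assms by (intro cell_space_mono) blast
  then show ?thesis
    by (auto simp: layer_def continuous_map_in_subtopology)
qed

lemma hom_induced_layer_class:
  assumes "T \<subseteq> T'" "T' \<subseteq> cells_of_dim X n" "\<tau> \<in> T" "cell_space X low \<subseteq> B"
  shows "hom_induced (int n) (layer T) (cell_space X low) (layer T') B id (layer_class T \<tau>) =
    hom_induced (int n) (disk n) (disk_boundary n) (layer T') B (charmap X \<tau>) (disk_class n)"
proof -
  have "T \<subseteq> cells_of_dim X n" "\<tau> \<in> cells_of_dim X n"
    using assms by auto
  note \<tau> = this
  have "id \<in> cell_space X low \<rightarrow> B"
    using assms(4) by auto
  from hom_induced_compose'[OF continuous_charmap_layer[OF \<tau>(1) assms(3)] charmap_boundary_low[OF \<tau>(2)]
      continuous_layer_id[OF assms(1)] this]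
  show ?thesis
    unfolding layer_class_def by simp
qed

lemma layer_class_mono:
  assumes "T \<subseteq> T'" "T' \<subseteq> cells_of_dim X n" "\<tau> \<in> T"
  shows "hom_induced (int n) (layer T) (cell_space X low) (layer T') (cell_space X low) id (layer_class T \<tau>) =
    layer_class T' \<tau>"
  using hom_induced_layer_class[OF assms subset_refl] by (simp add: layer_class_def)

text \<open>The characteristic map of \<tau> already lands in the space without \<sigma>, so its
  class passes through the homology of that space relative to itself, which is trivial.\<close>

lemma layer_class_other:
  assumes T: "T \<subseteq> cells_of_dim X n" and "\<tau> \<in> T" "\<sigma> \<in> T" "\<tau> \<noteq> \<sigma>"
  defines "B \<equiv> cell_space X (low \<union> (T - {\<sigma>}))"
  shows "hom_induced (int n) (layer T) (cell_space X low) (layer T) B id (layer_class T \<tau>) =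
    \<one>\<^bsub>relative_homology_group (int n) (layer T) B\<^esub>"
proof -
  let ?T = "T - {\<sigma>}"
  have T': "?T \<subseteq> cells_of_dim X n" "\<tau> \<in> ?T" "\<tau> \<in> cells_of_dim X n"
    using T assms(2,4) by auto
  have lowB: "cell_space X low \<subseteq> B"
    unfolding B_def by (intro cell_space_mono) auto
  have "hom_induced (int n) (layer T) (cell_space X low) (layer T) B id (layer_class T \<tau>) =
      hom_induced (int n) (disk n) (disk_boundary n) (layer T) B (charmap X \<tau>) (disk_class n)"
    by (rule hom_induced_layer_class[OF subset_refl T assms(2) lowB])
  also have "\<dots> = hom_induced (int n) (layer ?T) B (layer T) B id
      (hom_induced (int n) (disk n) (disk_boundary n) (layer ?T) B (charmap X \<tau>) (disk_class n))"
  proof -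
    have bd: "charmap X \<tau> \<in> disk_boundary n \<rightarrow> B"
      using charmap_boundary_low[OF T'(3)] lowB by blast
    have "continuous_map (layer ?T) (layer T) id" "id \<in> B \<rightarrow> B"
      by (rule continuous_layer_id) auto
    from hom_induced_compose'[OF continuous_charmap_layer[OF T'(1,2)] bd this]
    show ?thesis by simp
  qed
  also have "hom_induced (int n) (disk n) (disk_boundary n) (layer ?T) B (charmap X \<tau>) (disk_class n) =
      \<one>\<^bsub>relative_homology_group (int n) (layer ?T) B\<^esub>"
  proof -
    have "trivial_group (relative_homology_group (int n) (layer ?T) B)"
      unfolding B_def topspace_layer[OF T'(1), symmetric]
      by (rule trivial_relative_homology_group_topspace)
    then show ?thesis
      by (rule trivial_groupD) (rule hom_induced_carrier)
  qed
  also have "hom_induced (int n) (layer ?T) B (layer T) B id \<one>\<^bsub>relative_homology_group (int n) (layer ?T) B\<^esub> =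
      \<one>\<^bsub>relative_homology_group (int n) (layer T) B\<^esub>"
    by (rule hom_one[OF hom_induced_hom]) auto
  finally show ?thesis .
qed

lemma layer_class_carrier: "layer_class T \<tau> \<in> carrier (layer_group T)"
  by (simp add: layer_class_def hom_induced_carrier)

text \<open>Induction over the attached cells with the exact sequence of the triple (new layer, old
  layer, lower skeleton). A multiple of the new class accounts for the image of \<open>x\<close>
  modulo the old layer; the rest comes from the old layer.\<close>

lemma layer_group_generated:
  assumes "finite T" "T \<subseteq> cells_of_dim X n" "x \<in> carrier (layer_group T)"
  shows "\<exists>c :: 'c \<Rightarrow> int. x = finprod (layer_group T) (\<lambda>\<tau>. layer_class T \<tau> [^]\<^bsub>layer_group T\<^esub> c \<tau>) T"
  using assms
proof (induction T arbitrary: x)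
  case empty
  have "trivial_group (layer_group {})"
    using trivial_relative_homology_group_topspace[of "int n" "layer {}"] topspace_layer[of "{}"] by simp
  then have "x = \<one>\<^bsub>layer_group {}\<^esub>"
    using empty.prems(2) by (rule trivial_groupD)
  then show ?case
    by (simp add: comm_monoid.finprod_empty comm_group.axioms(1))
next
  case (insert \<sigma> T)
  let ?T = "insert \<sigma> T" and ?B = "cell_space X (low \<union> T)"
  let ?H = "relative_homology_group (int n) (layer ?T) ?B"
  let ?D = "relative_homology_group (int n) (disk n) (disk_boundary n)"
  let ?i = "hom_induced (int n) (layer T) (cell_space X low) (layer ?T) (cell_space X low) id"
  let ?j = "hom_induced (int n) (layer ?T) (cell_space X low) (layer ?T) ?B id"
  let ?f = "hom_induced (int n) (disk n) (disk_boundary n) (layer ?T) ?B (charmap X \<sigma>)"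
  interpret G: comm_group "layer_group ?T" by simp
  interpret GT: comm_group "layer_group T" by simp
  interpret D: group ?D by simp
  interpret j: group_hom "layer_group ?T" ?H ?j
    by (simp add: group_hom_def group_hom_axioms_def hom_induced_hom)
  interpret f: group_hom ?D ?H ?f
    by (simp add: group_hom_def group_hom_axioms_def hom_induced_hom)
  have B: "cell_space X (low \<union> (?T - {\<sigma>})) = ?B"
    using insert.hyps(2) by (simp add: Diff_insert_absorb)
  have lowB: "cell_space X low \<subseteq> ?B"
    by (intro cell_space_mono) auto
  interpret attached_cell "layer ?T" ?B n "charmap X \<sigma>"
    using attached_cell_layer[OF insert.prems(1), of \<sigma>] B by simp
  have "?j x \<in> ?f ` carrier ?D"
    using iso_attached_cell[of "int n"] hom_induced_carrier by (auto simp: iso_def bij_betw_def)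
  \<comment> \<open>The group of the new layer modulo the old one is infinite cyclic, generated by
    the image of \<open>disk_class n\<close>; \<open>k\<close> is the coefficient of the new
    cell.\<close>
  then obtain k :: int where k: "?j x = ?f (disk_class n [^]\<^bsub>?D\<^esub> k)"
    using carrier_disk_homology by auto
  have jc: "?j (layer_class ?T \<sigma>) = ?f (disk_class n)"
    by (rule hom_induced_layer_class[OF subset_refl insert.prems(1) insertI1 lowB])
  let ?c = "layer_class ?T \<sigma>"
  have jk: "?j (?c [^]\<^bsub>layer_group ?T\<^esub> k) = ?j x"
    using j.hom_int_pow[OF layer_class_carrier] f.hom_int_pow[OF disk_class_carrier] k jc by simp
  define y where "y = x \<otimes>\<^bsub>layer_group ?T\<^esub> inv\<^bsub>layer_group ?T\<^esub> (?c [^]\<^bsub>layer_group ?T\<^esub> k)"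
  have y: "y \<in> carrier (layer_group ?T)"
    using insert.prems(2) layer_class_carrier by (simp add: y_def)
  have "?j y = \<one>\<^bsub>?H\<^esub>"
    using insert.prems(2) layer_class_carrier hom_induced_carrier jk by (simp add: y_def)
  moreover have "subtopology (layer ?T) ?B = layer T"
  proof -
    have "?B \<subseteq> cell_space X (low \<union> ?T)"
      by (intro cell_space_mono) auto
    then show ?thesis
      by (simp add: layer_def subtopology_subtopology Int_absorb1)
  qed
  ultimately have "y \<in> ?i ` carrier (layer_group T)"
    using homology_exactness_triple_3[OF lowB, of "int n" "layer ?T"] y by (auto simp: kernel_def)
  then obtain z where z: "z \<in> carrier (layer_group T)" "y = ?i z" by blast
  obtain c :: "'c \<Rightarrow> int" where c: "z = finprod (layer_group T) (\<lambda>\<tau>. layer_class T \<tau> [^]\<^bsub>layer_group T\<^esub> c \<tau>) T"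
    using insert.IH insert.prems(1) z(1) by blast
  have "y = finprod (layer_group ?T) (\<lambda>\<tau>. ?i (layer_class T \<tau> [^]\<^bsub>layer_group T\<^esub> c \<tau>)) T"
    unfolding z(2) c
    by (rule hom_finprod) (use insert.hyps layer_class_carrier in \<open>auto simp: hom_induced_hom\<close>)
  also have "\<dots> = finprod (layer_group ?T) (\<lambda>\<tau>. layer_class ?T \<tau> [^]\<^bsub>layer_group ?T\<^esub> c \<tau>) T"
  proof (rule G.finprod_cong')
    fix \<tau> assume "\<tau> \<in> T"
    have "?i (layer_class T \<tau> [^]\<^bsub>layer_group T\<^esub> c \<tau>) = ?i (layer_class T \<tau>) [^]\<^bsub>layer_group ?T\<^esub> c \<tau>"
      by (rule hom_int_pow[OF hom_induced_hom layer_class_carrier]) simp_all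
    then show "?i (layer_class T \<tau> [^]\<^bsub>layer_group T\<^esub> c \<tau>) = layer_class ?T \<tau> [^]\<^bsub>layer_group ?T\<^esub> c \<tau>"
      unfolding layer_class_mono[OF subset_insertI insert.prems(1) \<open>\<tau> \<in> T\<close>] .
  qed (use layer_class_carrier in auto)
  finally have y': "y = finprod (layer_group ?T) (\<lambda>\<tau>. layer_class ?T \<tau> [^]\<^bsub>layer_group ?T\<^esub> c \<tau>) T" .
  have ck: "?c [^]\<^bsub>layer_group ?T\<^esub> k \<in> carrier (layer_group ?T)"
    by (rule G.int_pow_closed[OF layer_class_carrier])
  have "y \<otimes>\<^bsub>layer_group ?T\<^esub> ?c [^]\<^bsub>layer_group ?T\<^esub> k = x"
    unfolding y_def using ck insert.prems(2) by (simp add: G.m_assoc del: one_relative_homology_group)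
  then have "x = ?c [^]\<^bsub>layer_group ?T\<^esub> k \<otimes>\<^bsub>layer_group ?T\<^esub> y"
    using G.m_comm[OF y ck] by simp
  \<comment> \<open>As \<sigma> is not in \<open>T\<close>, changing its coefficient does not affect
    the product over \<open>T\<close>.\<close>
  also have "y = finprod (layer_group ?T) (\<lambda>\<tau>. layer_class ?T \<tau> [^]\<^bsub>layer_group ?T\<^esub> (c(\<sigma> := k)) \<tau>) T"
    unfolding y' using insert.hyps(2) layer_class_carrier by (intro G.finprod_cong') auto
  also have "?c [^]\<^bsub>layer_group ?T\<^esub> k \<otimes>\<^bsub>layer_group ?T\<^esub> \<dots> =
      finprod (layer_group ?T) (\<lambda>\<tau>. layer_class ?T \<tau> [^]\<^bsub>layer_group ?T\<^esub> (c(\<sigma> := k)) \<tau>) ?T"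
    using insert.hyps layer_class_carrier by (subst G.finprod_insert) auto
  finally show ?case
    by (rule exI[of _ "c(\<sigma> := k)"])
qed

text \<open>Modulo all cells but \<sigma> every other class dies, and the relation becomes a power
  of a generator of an infinite cyclic group.\<close>

lemma layer_group_independent:
  assumes "finite T" "T \<subseteq> cells_of_dim X n" "\<sigma> \<in> T"
    and one: "finprod (layer_group T) (\<lambda>\<tau>. layer_class T \<tau> [^]\<^bsub>layer_group T\<^esub> (c \<tau> :: int)) T = \<one>\<^bsub>layer_group T\<^esub>"
  shows "c \<sigma> = 0"
proof -
  let ?B = "cell_space X (low \<union> (T - {\<sigma>}))"
  let ?H = "relative_homology_group (int n) (layer T) ?B"
  let ?D = "relative_homology_group (int n) (disk n) (disk_boundary n)"
  let ?j = "hom_induced (int n) (layer T) (cell_space X low) (layer T) ?B id"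
  let ?f = "hom_induced (int n) (disk n) (disk_boundary n) (layer T) ?B (charmap X \<sigma>)"
  interpret G: comm_group "layer_group T" by simp
  interpret H: comm_group ?H by simp
  interpret D: group ?D by simp
  interpret f: group_hom ?D ?H ?f
    by (simp add: group_hom_def group_hom_axioms_def hom_induced_hom)
  interpret j: group_hom "layer_group T" ?H ?j
    by (simp add: group_hom_def group_hom_axioms_def hom_induced_hom)
  interpret attached_cell "layer T" ?B n "charmap X \<sigma>"
    by (rule attached_cell_layer[OF assms(2,3)])
  have lowB: "cell_space X low \<subseteq> ?B"
    by (intro cell_space_mono) auto
  have jc: "?j (layer_class T \<sigma>) = ?f (disk_class n)"
    by (rule hom_induced_layer_class[OF subset_refl assms(2,3) lowB])
  have "\<one>\<^bsub>?H\<^esub> = ?j (finprod (layer_group T) (\<lambda>\<tau>. layer_class T \<tau> [^]\<^bsub>layer_group T\<^esub> c \<tau>) T)"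
    unfolding one by (rule j.hom_one[symmetric])
  also have "\<dots> = finprod ?H (\<lambda>\<tau>. ?j (layer_class T \<tau> [^]\<^bsub>layer_group T\<^esub> c \<tau>)) T"
    by (rule hom_finprod) (use assms layer_class_carrier in \<open>auto simp: hom_induced_hom\<close>)
  also have "\<dots> = finprod ?H (\<lambda>\<tau>. if \<sigma> = \<tau> then ?f (disk_class n [^]\<^bsub>?D\<^esub> c \<tau>) else \<one>\<^bsub>?H\<^esub>) T"
  proof (rule H.finprod_cong')
    fix \<tau> assume \<tau>: "\<tau> \<in> T"
    show "?j (layer_class T \<tau> [^]\<^bsub>layer_group T\<^esub> c \<tau>) =
        (if \<sigma> = \<tau> then ?f (disk_class n [^]\<^bsub>?D\<^esub> c \<tau>) else \<one>\<^bsub>?H\<^esub>)"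
      using j.hom_int_pow[OF layer_class_carrier] f.hom_int_pow[OF disk_class_carrier] jc
        layer_class_other[OF assms(2) \<tau> assms(3)] H.int_pow_one by auto
  qed (auto simp: hom_induced_carrier simp del: one_relative_homology_group)
  also have "\<dots> = ?f (disk_class n [^]\<^bsub>?D\<^esub> c \<sigma>)"
    using assms(1,3) by (intro H.finprod_singleton) (auto simp: hom_induced_carrier)
  finally have "?f (disk_class n [^]\<^bsub>?D\<^esub> c \<sigma>) = \<one>\<^bsub>?H\<^esub>" by simp
  moreover have "?f \<in> iso ?D ?H"
    by (rule iso_attached_cell)
  ultimately have "disk_class n [^]\<^bsub>?D\<^esub> c \<sigma> = \<one>\<^bsub>?D\<^esub>"
    using f.iso_iff disk_class_carrier D.int_pow_closed by blast
  then show ?thesis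
    by (rule disk_class_pow_eq_one)
qed

lemma skeleton_below_eq: "skeleton_below X n = cell_space X low"
  by (simp add: skeleton_below_def cell_space_def)

lemma underlying_skeleton_eq: "underlying (skeleton X n) = layer (cells_of_dim X n)"
proof -
  have "{\<sigma> \<in> cells X. cdim X \<sigma> \<le> n} = low \<union> cells_of_dim X n"
    by (auto simp: cells_of_dim_def)
  then show ?thesis
    by (simp add: skeleton_def subcomplex_def layer_def cell_space_def)
qed

lemma cellular_group_eq: "cellular_group X n = layer_group (cells_of_dim X n)"
  by (simp add: cellular_group_def skeleton_below_eq underlying_skeleton_eq)

lemma cell_class_eq:
  assumes "\<tau> \<in> cells_of_dim X n"
  shows "cell_class X \<tau> = layer_class (cells_of_dim X n) \<tau>"
proof -
  have "cdim X \<tau> = n"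
    using assms by (simp add: cells_of_dim_def)
  then show ?thesis
    by (simp add: cell_class_def layer_class_def skeleton_below_eq underlying_skeleton_eq)
qed

lemma cell_class_carrier: "\<tau> \<in> cells_of_dim X n \<Longrightarrow> cell_class X \<tau> \<in> carrier (cellular_group X n)"
  by (simp add: cell_class_eq cellular_group_eq layer_class_carrier)

lemma finprod_cell_class_eq:
  "finprod (cellular_group X n) (\<lambda>\<tau>. cell_class X \<tau> [^]\<^bsub>cellular_group X n\<^esub> (c \<tau> :: int)) (cells_of_dim X n) =
    finprod (layer_group (cells_of_dim X n))
      (\<lambda>\<tau>. layer_class (cells_of_dim X n) \<tau> [^]\<^bsub>layer_group (cells_of_dim X n)\<^esub> c \<tau>) (cells_of_dim X n)"
proof -
  interpret comm_group "layer_group (cells_of_dim X n)" by simp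
  show ?thesis
    unfolding cellular_group_eq
    by (rule finprod_cong') (auto simp: cell_class_eq layer_class_carrier)
qed

lemma cellular_group_generated:
  assumes "x \<in> carrier (cellular_group X n)"
  shows "\<exists>c :: 'c \<Rightarrow> int. x =
    finprod (cellular_group X n) (\<lambda>\<tau>. cell_class X \<tau> [^]\<^bsub>cellular_group X n\<^esub> c \<tau>) (cells_of_dim X n)"
proof -
  have "x \<in> carrier (layer_group (cells_of_dim X n))"
    using assms by (simp only: cellular_group_eq)
  from layer_group_generated[OF finite_cells_of_dim[OF X, of n] subset_refl this]
  show ?thesis by (simp only: finprod_cell_class_eq)
qed

lemma cellular_group_independent:
  assumes "finprod (cellular_group X n) (\<lambda>\<tau>. cell_class X \<tau> [^]\<^bsub>cellular_group X n\<^esub> (c \<tau> :: int)) (cells_of_dim X n) =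
      \<one>\<^bsub>cellular_group X n\<^esub>"
    and "\<sigma> \<in> cells_of_dim X n"
  shows "c \<sigma> = 0"
  by (rule layer_group_independent[OF finite_cells_of_dim[OF X, of n] subset_refl assms(2)
        assms(1)[unfolded finprod_cell_class_eq, unfolded cellular_group_eq]])

end

section \<open>The cellular boundary squares to zero\<close>

context
  fixes X :: "('a, 'c) cell_complex"
  assumes X: "finite_cell_complex X"
begin

lemma comm_group_cellular_group: "comm_group (cellular_group X n)"
  by (simp add: cellular_group_def)

lemma subtopology_skeleton:
  "subtopology (underlying (skeleton X (Suc n))) (skeleton_below X (Suc n)) = underlying (skeleton X n)"
proof -
  have *: "underlying (skeleton X m) = subtopology (underlying X) (cell_space X {\<sigma> \<in> cells X. cdim X \<sigma> \<le> m})" for m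
    by (simp add: skeleton_def subcomplex_def cell_space_def)
  have "cell_space X {\<sigma> \<in> cells X. cdim X \<sigma> \<le> n} \<subseteq> cell_space X {\<sigma> \<in> cells X. cdim X \<sigma> \<le> Suc n}"
    by (rule cell_space_mono) auto
  moreover have "skeleton_below X (Suc n) = cell_space X {\<sigma> \<in> cells X. cdim X \<sigma> \<le> n}"
    by (simp add: skeleton_below_def cell_space_def less_Suc_eq_le)
  ultimately show ?thesis
    by (simp add: * subtopology_subtopology Int_absorb1)
qed

lemma integral_boundary_hom: "integral_boundary X n \<in> hom (cellular_group X (Suc n)) (cellular_group X n)"
  using group_homomorphism_hom_relboundary[of "int (Suc n)" "underlying (skeleton X (Suc n))"
      "skeleton_below X (Suc n)" "skeleton_below X n"]
  by (simp add: integral_boundary_def cellular_group_def subtopology_skeleton)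

text \<open>The composite contains two consecutive maps of the long exact sequence of the pair
  (X^(n+1), X^n): from absolute to relative homology, then the connecting map.\<close>

lemma integral_boundary_boundary:
  assumes "x \<in> carrier (cellular_group X (Suc (Suc n)))"
  shows "integral_boundary X n (integral_boundary X (Suc n) x) = \<one>\<^bsub>cellular_group X n\<^esub>"
proof -
  let ?X = "\<lambda>n. underlying (skeleton X n)" and ?A = "skeleton_below X"
  let ?b = "hom_boundary (int (Suc (Suc n))) (?X (Suc (Suc n))) (?A (Suc (Suc n))) x"
  have ints: "int (Suc m) - 1 = int m" for m
    by simp
  have b: "?b \<in> carrier (homology_group (int (Suc n)) (?X (Suc n)))"
    using hom_boundary_carrier[of "int (Suc (Suc n))" "?X (Suc (Suc n))" "?A (Suc (Suc n))"]
    by (simp only: subtopology_skeleton ints)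
  have "kernel (relative_homology_group (int (Suc n)) (?X (Suc n)) (?A (Suc n)))
        (homology_group (int (Suc n) - 1) (subtopology (?X (Suc n)) (?A (Suc n))))
        (hom_boundary (int (Suc n)) (?X (Suc n)) (?A (Suc n))) =
      hom_induced (int (Suc n)) (?X (Suc n)) {} (?X (Suc n)) (?A (Suc n)) id `
        carrier (homology_group (int (Suc n)) (?X (Suc n)))"
    using homology_exactness_axiom_1[of "int (Suc n)" "?X (Suc n)" "?A (Suc n)"]
    by (simp only: exact_seq_cons_iff)
  from b this have "hom_induced (int (Suc n)) (?X (Suc n)) {} (?X (Suc n)) (?A (Suc n)) id ?b \<in>
      kernel (relative_homology_group (int (Suc n)) (?X (Suc n)) (?A (Suc n)))
        (homology_group (int (Suc n) - 1) (subtopology (?X (Suc n)) (?A (Suc n))))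
        (hom_boundary (int (Suc n)) (?X (Suc n)) (?A (Suc n)))"
    by (simp only: imageI)
  then have "hom_boundary (int (Suc n)) (?X (Suc n)) (?A (Suc n))
      (hom_induced (int (Suc n)) (?X (Suc n)) {} (?X (Suc n)) (?A (Suc n)) id ?b) =
      \<one>\<^bsub>homology_group (int (Suc n) - 1) (subtopology (?X (Suc n)) (?A (Suc n)))\<^esub>"
    by (simp only: kernel_def mem_Collect_eq)
  then have "integral_boundary X n (integral_boundary X (Suc n) x) =
      hom_induced (int n) (?X n) {} (?X n) (?A n) id \<one>\<^bsub>homology_group (int n) (?X n)\<^esub>"
    by (simp only: integral_boundary_def hom_relboundary_def subtopology_skeleton ints o_apply)
  also have "\<dots> = \<one>\<^bsub>cellular_group X n\<^esub>"
    unfolding cellular_group_def by (rule hom_one[OF hom_induced_hom group_relative_homology_group group_relative_homology_group])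
  finally show ?thesis .
qed

text \<open>Generation supplies the witness for the \<open>SOME\<close> in \<open>incidence\<close>.
  The next lemma knows the incidence numbers through this equation alone.\<close>

lemma integral_boundary_cell_class:
  assumes "\<sigma> \<in> cells_of_dim X (Suc n)"
  shows "integral_boundary X n (cell_class X \<sigma>) =
    finprod (cellular_group X n) (\<lambda>\<tau>. cell_class X \<tau> [^]\<^bsub>cellular_group X n\<^esub> incidence X n \<sigma> \<tau>) (cells_of_dim X n)"
proof -
  have "integral_boundary X n (cell_class X \<sigma>) \<in> carrier (cellular_group X n)"
    using integral_boundary_hom cell_layer.cell_class_carrier[OF cell_layer.intro[OF X] assms]
    by (rule hom_in_carrier)
  from someI_ex[OF cell_layer.cellular_group_generated[OF cell_layer.intro[OF X] this]]
  show ?thesis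
    unfolding incidence_def .
qed

text \<open>The sum is the exponent of \<rho> in the double boundary of the class of \<sigma>, which
  is trivial; independence of the classes makes each exponent zero.\<close>

lemma incidence_incidence:
  assumes \<sigma>: "\<sigma> \<in> cells_of_dim X (Suc (Suc n))" and \<rho>: "\<rho> \<in> cells_of_dim X n"
  shows "(\<Sum>\<tau>\<in>cells_of_dim X (Suc n). incidence X (Suc n) \<sigma> \<tau> * incidence X n \<tau> \<rho>) = 0"
proof -
  let ?G = "cellular_group X n" and ?G' = "cellular_group X (Suc n)"
  interpret G: comm_group ?G by (rule comm_group_cellular_group)
  interpret G': comm_group ?G' by (rule comm_group_cellular_group)
  note layer = cell_layer.intro[OF X]
  note carr = cell_layer.cell_class_carrier[OF layer]
  note fin = finite_cells_of_dim[OF X]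
  let ?d = "\<lambda>\<tau>. finprod ?G (\<lambda>\<rho>. cell_class X \<rho> [^]\<^bsub>?G\<^esub> incidence X n \<tau> \<rho>) (cells_of_dim X n)"
  have pow: "(\<lambda>\<tau>. cell_class X \<tau> [^]\<^bsub>?G\<^esub> c \<tau>) \<in> cells_of_dim X n \<rightarrow> carrier ?G" for c :: "'c \<Rightarrow> int"
    by (intro Pi_I G.int_pow_closed carr)
  have pow': "(\<lambda>\<tau>. cell_class X \<tau> [^]\<^bsub>?G'\<^esub> c \<tau>) \<in> cells_of_dim X (Suc n) \<rightarrow> carrier ?G'" for c :: "'c \<Rightarrow> int"
    by (intro Pi_I G'.int_pow_closed carr)
  have "\<one>\<^bsub>?G\<^esub> = integral_boundary X n (integral_boundary X (Suc n) (cell_class X \<sigma>))"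
    by (rule integral_boundary_boundary[symmetric]) (rule carr[OF \<sigma>])
  also have "\<dots> = finprod ?G
      (\<lambda>\<tau>. integral_boundary X n (cell_class X \<tau> [^]\<^bsub>?G'\<^esub> incidence X (Suc n) \<sigma> \<tau>)) (cells_of_dim X (Suc n))"
    unfolding integral_boundary_cell_class[OF \<sigma>]
    by (rule hom_finprod[OF comm_group_cellular_group comm_group_cellular_group integral_boundary_hom fin pow'])
  also have "\<dots> = finprod ?G (\<lambda>\<tau>. ?d \<tau> [^]\<^bsub>?G\<^esub> incidence X (Suc n) \<sigma> \<tau>) (cells_of_dim X (Suc n))"
  proof (rule G.finprod_cong'[OF refl])
    show "(\<lambda>\<tau>. ?d \<tau> [^]\<^bsub>?G\<^esub> incidence X (Suc n) \<sigma> \<tau>) \<in> cells_of_dim X (Suc n) \<rightarrow> carrier ?G"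
      by (intro Pi_I G.int_pow_closed G.finprod_closed pow)
    fix \<tau> assume \<tau>: "\<tau> \<in> cells_of_dim X (Suc n)"
    show "integral_boundary X n (cell_class X \<tau> [^]\<^bsub>?G'\<^esub> incidence X (Suc n) \<sigma> \<tau>) =
        ?d \<tau> [^]\<^bsub>?G\<^esub> incidence X (Suc n) \<sigma> \<tau>"
      unfolding integral_boundary_cell_class[OF \<tau>, symmetric]
      by (rule hom_int_pow[OF integral_boundary_hom carr[OF \<tau>] G'.is_group G.is_group])
  qed
  also have "\<dots> = finprod ?G (\<lambda>\<rho>. cell_class X \<rho> [^]\<^bsub>?G\<^esub>
      (\<Sum>\<tau>\<in>cells_of_dim X (Suc n). incidence X (Suc n) \<sigma> \<tau> * incidence X n \<tau> \<rho>)) (cells_of_dim X n)"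
    by (rule G.finprod_int_pow_sum[OF fin fin]) (intro Pi_I carr)
  finally show ?thesis
    by (rule cell_layer.cellular_group_independent[OF layer sym \<rho>])
qed

lemma cellular_boundary_boundary:
  "cellular_boundary X n (cellular_boundary X (Suc n) f) = 0"
proof (cases n)
  case 0
  then show ?thesis by (simp add: zero_fun_def)
next
  case (Suc m)
  have "(\<Sum>\<tau>\<in>cells_of_dim X (Suc m). (\<Sum>\<sigma>\<in>cells_of_dim X (Suc (Suc m)).
      f \<sigma> * of_int (incidence X (Suc m) \<sigma> \<tau>)) * of_int (incidence X m \<tau> \<rho>)) = 0"
    if "\<rho> \<in> cells_of_dim X m" for \<rho>
  proof -
    have "(\<Sum>\<tau>\<in>cells_of_dim X (Suc m). (\<Sum>\<sigma>\<in>cells_of_dim X (Suc (Suc m)).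
          f \<sigma> * of_int (incidence X (Suc m) \<sigma> \<tau>)) * of_int (incidence X m \<tau> \<rho>)) =
        (\<Sum>\<sigma>\<in>cells_of_dim X (Suc (Suc m)). \<Sum>\<tau>\<in>cells_of_dim X (Suc m).
          f \<sigma> * of_int (incidence X (Suc m) \<sigma> \<tau> * incidence X m \<tau> \<rho>))"
      \<comment> \<open>Summing over the intermediate cells \<tau> first isolates the integer sum
        that vanishes before it is mapped to the field.\<close>
      by (subst sum.swap) (simp add: sum_distrib_right mult.assoc)
    also have "\<dots> = (\<Sum>\<sigma>\<in>cells_of_dim X (Suc (Suc m)). f \<sigma> *
        of_int (\<Sum>\<tau>\<in>cells_of_dim X (Suc m). incidence X (Suc m) \<sigma> \<tau> * incidence X m \<tau> \<rho>))"
      by (simp add: sum_distrib_left)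
    also have "\<dots> = 0"
      using incidence_incidence that by (intro sum.neutral) simp
    finally show ?thesis .
  qed
  then show ?thesis
    by (auto simp: Suc zero_fun_def cong: if_cong)
qed

lemma boundaries_subset_cycles: "boundaries X n \<subseteq> cycles X n"
  using cellular_boundary_boundary cellular_boundary_in_chains
  by (auto simp: boundaries_def cycles_def simp del: cellular_boundary.simps)

end

section \<open>Subcomplexes\<close>

lemma subcomplex_simps [simp]:
  "cells (subcomplex X C) = C" "cdim (subcomplex X C) = cdim X" "charmap (subcomplex X C) = charmap X"
  "underlying (subcomplex X C) = subtopology (underlying X) (cell_space X C)"
  by (simp_all add: subcomplex_def cell_space_def)

lemma open_cell_subcomplex [simp]: "open_cell (subcomplex X C) = open_cell X"
  by (simp add: open_cell_def fun_eq_iff)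

lemma cell_space_subcomplex [simp]: "cell_space (subcomplex X C) = cell_space X"
  by (simp add: cell_space_def fun_eq_iff)

lemma finite_cell_complex_subcomplex:
  assumes X: "finite_cell_complex X" and C: "lower_cells X C"
  shows "finite_cell_complex (subcomplex X C)"
  unfolding finite_cell_complex_def subcomplex_simps open_cell_subcomplex
proof (intro conjI ballI)
  note CX = lower_cells_subset[OF C]
  show "Hausdorff_space (subtopology (underlying X) (cell_space X C))"
    by (simp add: Hausdorff_space_subtopology Hausdorff_underlying[OF X])
  show "finite C"
    using CX finite_cells[OF X] by (rule finite_subset)
  show "disjoint_family_on (open_cell X) C"
    using disjoint_open_cells[OF X] CX by (rule disjoint_family_on_mono[rotated])
  show "(\<Union>\<sigma>\<in>C. open_cell X \<sigma>) = topspace (subtopology (underlying X) (cell_space X C))"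
    using cell_space_mono[OF CX, of X] by (simp add: topspace_underlying[OF X] cell_space_def Int_absorb1)
  fix \<sigma> assume \<sigma>: "\<sigma> \<in> C"
  then have \<sigma>X: "\<sigma> \<in> cells X" using CX by blast
  have disk: "charmap X \<sigma> ` topspace (disk (cdim X \<sigma>)) \<subseteq> cell_space X C"
    by (rule charmap_disk[OF X C \<sigma>])
  show "continuous_map (disk (cdim X \<sigma>)) (subtopology (underlying X) (cell_space X C)) (charmap X \<sigma>)"
    using charmap_continuous[OF X \<sigma>X] disk
    by (simp add: continuous_map_in_subtopology image_subset_iff_funcset)
  have "embedding_map (subtopology (disk (cdim X \<sigma>)) (disk_interior (cdim X \<sigma>))) (underlying X) (charmap X \<sigma>)"
    using X \<sigma>X by (simp add: finite_cell_complex_def)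
  moreover have "charmap X \<sigma> ` topspace (subtopology (disk (cdim X \<sigma>)) (disk_interior (cdim X \<sigma>))) \<subseteq> cell_space X C"
    using disk by auto
  ultimately show "embedding_map (subtopology (disk (cdim X \<sigma>)) (disk_interior (cdim X \<sigma>)))
      (subtopology (underlying X) (cell_space X C)) (charmap X \<sigma>)"
    by (simp add: embedding_map_in_subtopology)
  have "{\<tau> \<in> cells X. cdim X \<tau> < cdim X \<sigma>} \<subseteq> {\<tau> \<in> C. cdim X \<tau> < cdim X \<sigma>}"
    using lower_cellsD[OF C \<sigma>] by blast
  from charmap_boundary[OF X \<sigma>X] cell_space_mono[OF this, of X]
  show "charmap X \<sigma> ` disk_boundary (cdim X \<sigma>) \<subseteq> (\<Union>\<tau>\<in>{\<tau> \<in> C. cdim X \<tau> < cdim X \<sigma>}. open_cell X \<tau>)"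
    unfolding cell_space_def by (rule order_trans)
qed

text \<open>The incidence numbers between cells of dimension at most \<open>m\<close> depend on the skeleton of
  dimension \<open>m\<close> only, even though they are chosen by a \<open>SOME\<close>.\<close>

locale same_skeleton =
  fixes X :: "('a, 'c) cell_complex" and C :: "'c set" and m :: nat
  assumes X: "finite_cell_complex X" and C: "lower_cells X C"
    and agree: "{\<sigma> \<in> cells X. cdim X \<sigma> \<le> m} \<subseteq> C"
begin

abbreviation "Y \<equiv> subcomplex X C"

lemma cells_le:
  assumes "k \<le> m"
  shows "{\<sigma> \<in> C. cdim X \<sigma> \<le> k} = {\<sigma> \<in> cells X. cdim X \<sigma> \<le> k}"
    and "{\<sigma> \<in> C. cdim X \<sigma> < k} = {\<sigma> \<in> cells X. cdim X \<sigma> < k}"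
  using agree lower_cells_subset[OF C] assms by (auto simp: subset_iff)

lemma cells_of_dim_eq: "k \<le> m \<Longrightarrow> cells_of_dim Y k = cells_of_dim X k"
  using agree lower_cells_subset[OF C] by (auto simp: cells_of_dim_def subset_iff)

lemma skeleton_eq:
  assumes "k \<le> m"
  shows "underlying (skeleton Y k) = underlying (skeleton X k)"
    and "skeleton_below Y k = skeleton_below X k"
proof -
  have "cell_space X {\<sigma> \<in> cells X. cdim X \<sigma> \<le> k} \<subseteq> cell_space X C"
    using agree assms by (intro cell_space_mono) auto
  then show "underlying (skeleton Y k) = underlying (skeleton X k)"
    by (simp add: skeleton_def cells_le(1)[OF assms] subtopology_subtopology Int_absorb1)
  show "skeleton_below Y k = skeleton_below X k"
    by (simp add: skeleton_below_def cells_le(2)[OF assms])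
qed

lemma cellular_group_eq: "k \<le> m \<Longrightarrow> cellular_group Y k = cellular_group X k"
  by (simp add: cellular_group_def skeleton_eq)

lemma cell_class_eq: "cdim X \<sigma> \<le> m \<Longrightarrow> cell_class Y \<sigma> = cell_class X \<sigma>"
  by (simp add: cell_class_def skeleton_eq)

text \<open>Once groups, boundary maps and classes are identified, both \<open>SOME\<close> choose
  from the same predicate. The chosen functions therefore agree everywhere, also off the
  \<open>n\<close>-cells where the predicate leaves them free.\<close>

lemma incidence_eq:
  assumes "Suc n \<le> m" "\<sigma> \<in> cells_of_dim X (Suc n)"
  shows "incidence Y n \<sigma> = incidence X n \<sigma>"
proof -
  interpret G: comm_group "cellular_group X n" by (rule comm_group_cellular_group[OF X])
  have n: "n \<le> m" using assms by simp
  have b: "integral_boundary Y n = integral_boundary X n"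
    using assms(1) n by (simp add: integral_boundary_def skeleton_eq)
  have c: "cell_class Y \<sigma> = cell_class X \<sigma>"
    using assms by (intro cell_class_eq) (simp add: cells_of_dim_def)
  \<comment> \<open>The classes are known to agree on cells of dimension at most \<open>m\<close>
    only, so the products are compared on their index set.\<close>
  have "finprod (cellular_group X n) (\<lambda>\<tau>. cell_class Y \<tau> [^]\<^bsub>cellular_group X n\<^esub> (c \<tau> :: int)) (cells_of_dim X n) =
      finprod (cellular_group X n) (\<lambda>\<tau>. cell_class X \<tau> [^]\<^bsub>cellular_group X n\<^esub> c \<tau>) (cells_of_dim X n)" for c
  proof (rule G.finprod_cong'[OF refl])
    show "(\<lambda>\<tau>. cell_class X \<tau> [^]\<^bsub>cellular_group X n\<^esub> c \<tau>) \<in> cells_of_dim X n \<rightarrow> carrier (cellular_group X n)"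
      by (intro Pi_I G.int_pow_closed cell_layer.cell_class_carrier[OF cell_layer.intro[OF X]])
  qed (use n in \<open>simp add: cell_class_eq cells_of_dim_def\<close>)
  then show ?thesis
    unfolding incidence_def cellular_group_eq[OF n] cells_of_dim_eq[OF n] b c by simp
qed

lemma cellular_boundary_eq: "k \<le> m \<Longrightarrow> cellular_boundary Y k f = cellular_boundary X k f"
  by (cases k) (auto simp: fun_eq_iff cells_of_dim_eq incidence_eq)

lemma boundary_rank_eq:
  assumes "k \<le> m"
  shows "boundary_rank TYPE('k::field) Y k = boundary_rank TYPE('k) X k"
proof -
  have "cellular_boundary Y k = (cellular_boundary X k :: ('c \<Rightarrow> 'k) \<Rightarrow> _)"
    using cellular_boundary_eq[OF assms] by (rule ext)
  moreover have "(chains Y k :: ('c \<Rightarrow> 'k) set) = chains X k"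
    by (simp add: chains_def cells_of_dim_eq[OF assms])
  ultimately show ?thesis
    unfolding boundary_rank_def by (simp only:)
qed

end

lemma boundary_rank_no_cells:
  fixes X :: "('a, 'c) cell_complex"
  assumes "cells_of_dim X (Suc n) = {}"
  shows "boundary_rank TYPE('k::field) X (Suc n) = 0"
proof -
  have "(\<lambda>\<tau>. 0) \<in> (chains X (Suc n) :: ('c \<Rightarrow> 'k) set)"
    by (simp add: chains_def)
  moreover have "cellular_boundary X (Suc n) = (\<lambda>f :: 'c \<Rightarrow> 'k. 0)"
    using assms by (simp add: zero_fun_def fun_eq_iff)
  ultimately have "cellular_boundary X (Suc n) ` (chains X (Suc n) :: ('c \<Rightarrow> 'k) set) = {0}"
    by (auto simp del: cellular_boundary.simps)
  then show ?thesis
    unfolding boundary_rank_def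
    using chain_vs.dim_le_card[of "{0 :: 'c \<Rightarrow> 'k}" "{}"] chain_vs.span_zero by simp
qed

section \<open>The random-cluster model\<close>

text \<open>Here \<beta>, b1 are the Betti numbers in degree l - 1 of \<open>X\<close> and
  \<open>X_F\<close>; \<beta>', b2 those in degree l of \<open>X^l\<close> and \<open>X_F\<close>;
  r, s the ranks of \<open>\<partial>_l\<close> on \<open>X\<close> and \<open>X_F\<close>; M, F the
  numbers of l-cells.\<close>

lemma weight_eq_tutte_term:
  fixes p q :: real
  assumes p: "0 < p" "p < 1"
    and "\<beta> + r = b1 + s" "\<beta>' + r = M" "b2 + s = F" "F \<le> M"
  shows "p ^ F * (1 - p) ^ (M - F) * q ^ b1 =
    (p / (1 - p)) ^ \<beta> * p ^ r * (1 - p) ^ \<beta>' * ((q * (1 - p) / p) ^ b1 * (p / (1 - p)) ^ b2)"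
proof -
  \<comment> \<open>The exponents of p and of 1 - p on both sides, with the negative contributions
    moved across to stay within the natural numbers.\<close>
  have e: "\<beta> + r + b2 = F + b1" "\<beta>' + b1 = (M - F) + \<beta> + b2"
    using assms by linarith+
  have "p ^ \<beta> * p ^ r * p ^ b2 = p ^ F * p ^ b1" "(1 - p) ^ \<beta>' * (1 - p) ^ b1 = (1 - p) ^ (M - F) * (1 - p) ^ \<beta> * (1 - p) ^ b2"
    using e by (simp_all flip: power_add)
  then have "(p ^ F * p ^ b1) * ((1 - p) ^ (M - F) * (1 - p) ^ \<beta> * (1 - p) ^ b2) * q ^ b1 =
      (p ^ \<beta> * p ^ r * p ^ b2) * ((1 - p) ^ \<beta>' * (1 - p) ^ b1) * q ^ b1"
    by simp
  then show ?thesis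
    using p by (simp add: power_divide power_mult_distrib divide_simps) (simp add: ac_simps)
qed

lemma cells_of_dim_add_cells:
  assumes "F \<subseteq> cells_of_dim X l"
  shows "cells_of_dim (add_cells X l F) l = F"
    and "cells_of_dim (add_cells X l F) (Suc l) = {}"
  using assms by (auto simp: add_cells_def cells_of_dim_def)

text \<open>\<open>F\<close> may omit l-cells, so \<open>X_F\<close> is compared with
  \<open>X\<close> up to dimension \<open>m\<close> only, and the rank of its top boundary map is
  kept as it is. In degree \<open>Suc m\<close> no higher cells contribute a boundary term.\<close>

lemma betti_add_cells:
  fixes X :: "('a, 'c) cell_complex"
  assumes X: "finite_cell_complex X" and F: "F \<subseteq> cells_of_dim X (Suc m)"
  defines "Y \<equiv> add_cells X (Suc m) F"
  shows "betti TYPE('k::field) m Y + boundary_rank TYPE('k) Y (Suc m) + boundary_rank TYPE('k) X m =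
      card (cells_of_dim X m)"
    and "betti TYPE('k) (Suc m) Y + boundary_rank TYPE('k) Y (Suc m) = card F"
proof -
  let ?C = "{\<sigma> \<in> cells X. cdim X \<sigma> < Suc m} \<union> F"
  have YC: "Y = subcomplex X ?C"
    by (simp add: Y_def add_cells_def)
  have low: "lower_cells X ?C"
    using cell_layer.lower_cells_layer[OF cell_layer.intro[OF X] F] .
  interpret same_skeleton X ?C m
    using X low by unfold_locales auto
  have Y: "finite_cell_complex Y"
    unfolding YC by (rule finite_cell_complex_subcomplex[OF X low])
  note betti_Y = betti_eq[where 'k = 'k, OF finite_cells_of_dim[OF Y] boundaries_subset_cycles[OF Y]]
  show "betti TYPE('k) m Y + boundary_rank TYPE('k) Y (Suc m) + boundary_rank TYPE('k) X m =
      card (cells_of_dim X m)"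
    using betti_Y[of m] boundary_rank_eq[OF order_refl, where 'k = 'k] cells_of_dim_eq[OF order_refl]
    by (simp only: YC)
  show "betti TYPE('k) (Suc m) Y + boundary_rank TYPE('k) Y (Suc m) = card F"
    using betti_Y[of "Suc m"] boundary_rank_no_cells[of Y "Suc m", where 'k = 'k] cells_of_dim_add_cells[OF F]
    by (simp add: Y_def)
qed

text \<open>The case where \<open>F\<close> consists of all l-cells; then the comparison with
  \<open>X\<close> reaches dimension \<open>Suc m\<close> and identifies the rank too.\<close>

lemma betti_skeleton:
  fixes X :: "('a, 'c) cell_complex"
  assumes X: "finite_cell_complex X"
  shows "betti TYPE('k::field) (Suc m) (skeleton X (Suc m)) + boundary_rank TYPE('k) X (Suc m) =
    card (cells_of_dim X (Suc m))"
proof -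
  let ?C = "{\<sigma> \<in> cells X. cdim X \<sigma> \<le> Suc m}"
  have "lower_cells X ?C"
    by (auto simp: lower_cells_def)
  then interpret same_skeleton X ?C "Suc m"
    using X by unfold_locales auto
  have "?C = {\<sigma> \<in> cells X. cdim X \<sigma> < Suc m} \<union> cells_of_dim X (Suc m)"
    by (auto simp: cells_of_dim_def)
  then have "skeleton X (Suc m) = add_cells X (Suc m) (cells_of_dim X (Suc m))"
    by (simp add: skeleton_def add_cells_def)
  then show ?thesis
    using betti_add_cells(2)[OF X subset_refl, of m, where 'k = 'k] boundary_rank_eq[OF order_refl, where 'k = 'k]
    by (metis skeleton_def)
qed

theorem theorem5p3:
  fixes X :: "('a, 'c) cell_complex" and l :: nat and p q :: real
  assumes "finite_cell_complex X" and "l \<ge> 1"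
    and "0 < p" and "p < 1" and "q > 0"
  shows "rc_normalizer TYPE('k::field) X l p q =
    (p / (1 - p)) ^ betti TYPE('k) (l - 1) X *
    p ^ boundary_rank TYPE('k) X l *
    (1 - p) ^ betti TYPE('k) l (skeleton X l) *
    tutte TYPE('k) X l (1 + q * (1 - p) / p) (1 / (1 - p))"
proof -
  note X = assms(1)
  obtain m where l: "l = Suc m"
    using assms(2) by (cases l) auto
  then have lm: "l - 1 = m"
    by simp
  have finl: "finite (cells_of_dim X l)"
    by (rule finite_cells_of_dim[OF X])
  \<comment> \<open>\<open>Omega\<close> is a set of complexes, whereas the Tutte sum runs over sets
    of cells; \<open>F\<close> is recovered from \<open>X_F\<close> as its l-cells.\<close>
  have inj: "inj_on (add_cells X l) (Pow (cells_of_dim X l))"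
    by (rule inj_on_inverseI[where g = "\<lambda>Y. cells_of_dim Y l"]) (simp add: cells_of_dim_add_cells)
  have weight: "rc_weight TYPE('k) X l p q (add_cells X l F) =
      (p / (1 - p)) ^ betti TYPE('k) m X * p ^ boundary_rank TYPE('k) X l *
      (1 - p) ^ betti TYPE('k) l (skeleton X l) *
      ((q * (1 - p) / p) ^ betti TYPE('k) m (add_cells X l F) *
       (p / (1 - p)) ^ betti TYPE('k) l (add_cells X l F))"
    if F: "F \<subseteq> cells_of_dim X l" for F
  proof -
    have "betti TYPE('k) m X + boundary_rank TYPE('k) X l + boundary_rank TYPE('k) X m =
        card (cells_of_dim X m)"
      unfolding l by (rule betti_eq[OF finite_cells_of_dim[OF X] boundaries_subset_cycles[OF X]])
    with betti_add_cells[OF X F[unfolded l], where 'k = 'k]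
    \<comment> \<open>Comparing \<open>X\<close> with \<open>X_F\<close> in degree l - 1 cancels the
      common number of cells and the common rank of the lower boundary map.\<close>
    have eqs: "betti TYPE('k) m X + boundary_rank TYPE('k) X l =
        betti TYPE('k) m (add_cells X l F) + boundary_rank TYPE('k) (add_cells X l F) l"
      "betti TYPE('k) l (add_cells X l F) + boundary_rank TYPE('k) (add_cells X l F) l = card F"
      by (simp_all add: l)
    have "card F \<le> card (cells_of_dim X l)" "card (cells_of_dim X l - F) = card (cells_of_dim X l) - card F"
      using F finl by (auto simp: card_mono card_Diff_subset finite_subset)
    then show ?thesis
      using weight_eq_tutte_term[OF assms(3,4) eqs(1) betti_skeleton[OF X, of m, where 'k = 'k, folded l] eqs(2), of q]
      by (simp only: rc_weight_def cells_of_dim_add_cells(1)[OF F] lm)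
  qed
  have y: "1 / (1 - p) - 1 = p / (1 - p)"
    using assms(4) by (simp add: field_simps)
  have "rc_normalizer TYPE('k) X l p q =
      (\<Sum>F\<in>Pow (cells_of_dim X l). rc_weight TYPE('k) X l p q (add_cells X l F))"
    unfolding rc_normalizer_def Omega_def by (simp add: sum.reindex[OF inj])
  also have "\<dots> = (\<Sum>F\<in>Pow (cells_of_dim X l).
      (p / (1 - p)) ^ betti TYPE('k) m X * p ^ boundary_rank TYPE('k) X l *
      (1 - p) ^ betti TYPE('k) l (skeleton X l) *
      ((q * (1 - p) / p) ^ betti TYPE('k) m (add_cells X l F) *
       (p / (1 - p)) ^ betti TYPE('k) l (add_cells X l F)))"
    by (intro sum.cong refl weight) simp
  finally show ?thesis
    by (simp add: tutte_def y sum_distrib_left l)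
qed

end
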